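(* Let $K$ be a finite field, let $S=K[t_1,\ldots,t_s]$, let $I=I(X)$ be the vanishing ideal of a subset $X$ of $K^s$ with $|X|\ge 2$, let $r_0$ be the regularity index of $H_I^a$, let $u$ be a new variable, let $\prec$ be a graded monomial order on $S[u]$ with $t_1\succ\cdots\succ t_s\succ u$, and let $I^h$ be the homogenization of $I$ with respect to $u$. The following are equivalent. (a) The $h$-vector of $S[u]/I^h$ is symmetric. (b) $H_I^a(d)+H_I^a(r_0-d-1)=|X|$ for all integers $-1\leq d\leq r_0$. (c) $H_{\mathrm{in}_\prec(I)}(d)=H_{\mathrm{in}_\prec(I)}(r_0-d)$ for all integers $0\leq d\leq r_0$. (d) $|\Delta_\prec(I)\cap S_d|=|\Delta_\prec(I)\cap S_{r_0-d}|$ for all integers $0\leq d\leq r_0$.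
   Context: $I(X)$ is the ideal of all polynomials vanishing on $X$. A graded monomial order compares monomials first by total degree. $\mathrm{in}_\prec(I)\subset S$ is the initial ideal of $I$ with respect to the restriction of $\prec$ to $S$, and $\Delta_\prec(I)$ is the set of monomials of $S$ not in $\mathrm{in}_\prec(I)$. $S_d$ is the degree-$d$ homogeneous component of $S$ (standard grading). For $d\ge 0$, $S_{\le d}$ is the space of polynomials of total degree at most $d$; $S_{\le -1}=\{0\}$; $I_{\le d}=I\cap S_{\le d}$. $H_I^a(d)=\dim_K(S_{\le d}/I_{\le d})$ for $d\ge -1$, and $r_0$ is the least integer $\ell\ge 0$ with $H_I^a(d)=|X|$ for all $d\ge\ell$. For a graded ideal $J$ of $S$ (or of $S[u]$, correspondingly), $H_J(d)=\dim_K(S_d/(J\cap S_d))$ is its Hilbert function. For $f\in S$ of degree $e$, $f^h=u^e f(t_1/u,\ldots,t_s/u)$, and $I^h=(\{f^h: f\in I\})\subset S[u]$, where $S[u]$ has the standard grading. The $h$-vector of a standard graded algebra $R/J$ of Krull dimension $k$ ($R$ a polynomial ring, $J$ a graded ideal): write the Hilbert series as $\sum_{i\ge0}H_J(i)z^i=h(z)/(1-z)^k$ with $h(z)=\sum_{i=0}^r h_iz^i\in\mathbb{Z}[z]$, $h_r\ne 0$, $h(1)\ne 0$; then the $h$-vector is $(h_0,\ldots,h_r)$. It is symmetric if $h_i=h_{r-i}$ for $0\le i\le r$. *)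

theory Defs
  imports
    "HOL-Algebra.QuotRing"
    "HOL-Library.Poly_Mapping"
    "HOL-Library.FuncSet"
    "HOL-Library.Extended_Nat"
    "HOL-Computational_Algebra.Polynomial_FPS"
begin

text \<open>
  Monomials are exponent vectors, and polynomials are finitely supported coefficient functions
  on them. The variables are indexed by natural numbers, starting at 0. The polynomial ring in
  \<open>n\<close> variables consists of the polynomials that only involve the variables with index below
  \<open>n\<close>. Hence for \<open>S = K[t\<^sub>1,\<dots>,t\<^sub>s]\<close> the variable \<open>t\<^sub>i\<close> has index \<open>i - 1\<close>, and \<open>S[u]\<close> is the ring in
  \<open>s + 1\<close> variables where \<open>u\<close> has index \<open>s\<close>; thus \<open>S\<close> is literally a subset of \<open>S[u]\<close>.
\<close>

type_synonym monomial = "nat \<Rightarrow>\<^sub>0 nat"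
type_synonym 'a mpoly = "monomial \<Rightarrow>\<^sub>0 'a"

definition monomials :: "nat \<Rightarrow> monomial set" where
  "monomials n = {m. Poly_Mapping.keys m \<subseteq> {..<n}}"

definition mdeg :: "monomial \<Rightarrow> nat" where
  "mdeg m = (\<Sum>i\<in>Poly_Mapping.keys m. Poly_Mapping.lookup m i)"

definition var :: "nat \<Rightarrow> monomial" where
  "var i = Poly_Mapping.single i 1"

definition polys :: "nat \<Rightarrow> 'a::zero mpoly set" where
  "polys n = {p. Poly_Mapping.keys p \<subseteq> monomials n}"

definition poly_ring :: "nat \<Rightarrow> 'a::comm_ring_1 mpoly ring" where
  "poly_ring n = \<lparr>carrier = polys n, monoid.mult = (*), one = 1, zero = 0, add = (+)\<rparr>"

definition eval_mpoly :: "(nat \<Rightarrow> 'a::comm_ring_1) \<Rightarrow> 'a mpoly \<Rightarrow> 'a" where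
  "eval_mpoly x p = (\<Sum>m\<in>Poly_Mapping.keys p. Poly_Mapping.lookup p m *
     (\<Prod>i\<in>Poly_Mapping.keys m. x i ^ Poly_Mapping.lookup m i))"

definition affine_space :: "nat \<Rightarrow> (nat \<Rightarrow> 'a) set" where
  "affine_space n = ({..<n} \<rightarrow>\<^sub>E UNIV)"

definition vanishing_ideal :: "nat \<Rightarrow> (nat \<Rightarrow> 'a::comm_ring_1) set \<Rightarrow> 'a mpoly set" where
  "vanishing_ideal n X = {p \<in> polys n. \<forall>x\<in>X. eval_mpoly x p = 0}"

text \<open>The degree bound is an integer, so that \<open>polys_le n (-1) = {0}\<close>.\<close>

definition polys_le :: "nat \<Rightarrow> int \<Rightarrow> 'a::zero mpoly set" where
  "polys_le n d = {p \<in> polys n. \<forall>m\<in>Poly_Mapping.keys p. int (mdeg m) \<le> d}"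

definition homog_polys :: "nat \<Rightarrow> nat \<Rightarrow> 'a::zero mpoly set" where
  "homog_polys n d = {p \<in> polys n. \<forall>m\<in>Poly_Mapping.keys p. mdeg m = d}"

text \<open>
  \<open>quotient_basis V W B\<close>: the residue classes of the elements of \<open>B\<close> form a finite basis of
  \<open>V/W\<close>, with \<open>B\<close> containing exactly one representative of each basis vector. Scalar
  multiplication by \<open>c\<close> is multiplication by the constant polynomial \<open>Poly_Mapping.single 0 c\<close>.
\<close>

definition quotient_basis ::
    "'a::field mpoly set \<Rightarrow> 'a mpoly set \<Rightarrow> 'a mpoly set \<Rightarrow> bool" where
  "quotient_basis V W B \<longleftrightarrow> finite B \<and> B \<subseteq> V \<and>
     (\<forall>v\<in>V. \<exists>!c. c \<in> B \<rightarrow>\<^sub>E UNIV \<and> v - (\<Sum>b\<in>B. Poly_Mapping.single 0 (c b) * b) \<in> W)"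

text \<open>Only used for finite-dimensional quotients.\<close>

definition quotient_dim :: "'a::field mpoly set \<Rightarrow> 'a mpoly set \<Rightarrow> nat" where
  "quotient_dim V W = (THE k. \<exists>B. quotient_basis V W B \<and> card B = k)"

definition affine_hilbert :: "nat \<Rightarrow> 'a::field mpoly set \<Rightarrow> int \<Rightarrow> nat" where
  "affine_hilbert n I d = quotient_dim (polys_le n d) (I \<inter> polys_le n d)"

definition hilbert :: "nat \<Rightarrow> 'a::field mpoly set \<Rightarrow> nat \<Rightarrow> nat" where
  "hilbert n J d = quotient_dim (homog_polys n d) (J \<inter> homog_polys n d)"

definition regularity_index :: "nat \<Rightarrow> (nat \<Rightarrow> 'a::field) set \<Rightarrow> nat" where
  "regularity_index n X =
     (LEAST l. \<forall>d \<ge> int l. affine_hilbert n (vanishing_ideal n X) d = card X)"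

text \<open>\<open>(a, b) \<in> r\<close> means \<open>a \<preceq> b\<close>.\<close>

definition monomial_order :: "nat \<Rightarrow> monomial rel \<Rightarrow> bool" where
  "monomial_order n r \<longleftrightarrow> linear_order_on (monomials n) r \<and>
     (\<forall>m\<in>monomials n. (0, m) \<in> r) \<and>
     (\<forall>a\<in>monomials n. \<forall>b\<in>monomials n. \<forall>c\<in>monomials n. (a, b) \<in> r \<longrightarrow> (a + c, b + c) \<in> r)"

definition graded_monomial_order :: "nat \<Rightarrow> monomial rel \<Rightarrow> bool" where
  "graded_monomial_order n r \<longleftrightarrow> monomial_order n r \<and>
     (\<forall>a\<in>monomials n. \<forall>b\<in>monomials n. mdeg a < mdeg b \<longrightarrow> (a, b) \<in> r)"

definition lead_monomial :: "monomial rel \<Rightarrow> 'a::zero mpoly \<Rightarrow> monomial" where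
  "lead_monomial r f =
     (THE m. m \<in> Poly_Mapping.keys f \<and> (\<forall>m'\<in>Poly_Mapping.keys f. (m', m) \<in> r))"

definition initial_ideal :: "nat \<Rightarrow> monomial rel \<Rightarrow> 'a::comm_ring_1 mpoly set \<Rightarrow> 'a mpoly set" where
  "initial_ideal n r I =
     genideal (poly_ring n) ((\<lambda>f. Poly_Mapping.single (lead_monomial r f) 1) ` (I - {0}))"

text \<open>The standard monomials, regarded as polynomials.\<close>

definition standard_monomials ::
    "nat \<Rightarrow> monomial rel \<Rightarrow> 'a::comm_ring_1 mpoly set \<Rightarrow> 'a mpoly set" where
  "standard_monomials n r I = (\<lambda>m. Poly_Mapping.single m 1) ` monomials n - initial_ideal n r I"

definition total_deg :: "'a::zero mpoly \<Rightarrow> nat" where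
  "total_deg f = Max (insert 0 (mdeg ` Poly_Mapping.keys f))"

text \<open>
  Expanding \<open>u\<^sup>e f(t\<^sub>1/u,\<dots>,t\<^sub>s/u)\<close> for \<open>f\<close> of degree \<open>e\<close>, every term \<open>c t\<^sup>a\<close> of \<open>f\<close> becomes
  \<open>c t\<^sup>a u\<close> to the power \<open>e - |a|\<close>. The first argument is the index of the variable \<open>u\<close>.
\<close>

definition homogenize :: "nat \<Rightarrow> 'a::comm_ring_1 mpoly \<Rightarrow> 'a mpoly" where
  "homogenize u f = (\<Sum>m\<in>Poly_Mapping.keys f.
     Poly_Mapping.single (m + Poly_Mapping.single u (total_deg f - mdeg m))
       (Poly_Mapping.lookup f m))"

definition homogenization :: "nat \<Rightarrow> 'a::comm_ring_1 mpoly set \<Rightarrow> 'a mpoly set" where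
  "homogenization n I = genideal (poly_ring (Suc n)) (homogenize n ` I)"

definition krull_dim :: "('b, 'c) ring_scheme \<Rightarrow> enat" where
  "krull_dim R = Sup {enat k |k. \<exists>P. (\<forall>i\<le>k. primeideal (P i) R) \<and> (\<forall>i<k. P i \<subset> P (Suc i))}"

definition hilbert_series :: "nat \<Rightarrow> 'a::field mpoly set \<Rightarrow> int fps" where
  "hilbert_series n J = Abs_fps (\<lambda>i. int (hilbert n J i))"

text \<open>
  The numerator \<open>h(z)\<close> in \<open>hilbert_series n J = h(z)/(1 - z)\<^sup>k\<close>, where \<open>k\<close> is the Krull dimension of the
  quotient by \<open>J\<close> of the polynomial ring in \<open>n\<close> variables.
\<close>

definition h_polynomial :: "nat \<Rightarrow> 'a::field mpoly set \<Rightarrow> int poly" where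
  "h_polynomial n J = (THE h. \<exists>k. krull_dim (poly_ring n Quot J) = enat k \<and>
     hilbert_series n J * (1 - fps_X) ^ k = fps_of_poly h \<and> poly h 1 \<noteq> 0)"

definition h_vector :: "nat \<Rightarrow> 'a::field mpoly set \<Rightarrow> int list" where
  "h_vector n J = coeffs (h_polynomial n J)"

definition symmetric_vector :: "int list \<Rightarrow> bool" where
  "symmetric_vector v \<longleftrightarrow> (\<forall>i<length v. v ! i = v ! (length v - 1 - i))"

end

theory Submission
  imports Defs
begin

text \<open>
  Let \<open>\<delta> i\<close> be the number of standard monomials of degree \<open>i\<close>. All four conditions say that \<open>\<delta>\<close> is
  palindromic on \<open>{0..r0}\<close>.

  Because the order is graded, reduction modulo \<open>I\<close> never raises the degree. So the standard monomials
  of degree at most \<open>d\<close> are a basis of \<open>S\<^sub>\<le>\<^sub>d/I\<^sub>\<le>\<^sub>d\<close>, and the affine Hilbert function is the sequence of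
  partial sums of \<open>\<delta>\<close> (\<open>affine_hilbert_sum\<close>). The initial ideal is the span of the leading monomials, so its
  Hilbert function is \<open>\<delta>\<close> itself (\<open>hilbert_initial_ideal\<close>); thus (c) and (d) are literally the
  palindromicity of \<open>\<delta>\<close>. Separating polynomials for the points show that the partial sums reach \<open>|X|\<close>
  (\<open>affine_hilbert_eventually_card\<close>). Hence \<open>r0\<close> is the last index at which \<open>\<delta>\<close> is nonzero, and (b) says
  that the first \<open>d + 1\<close> and the last \<open>d + 1\<close> values of \<open>\<delta>\<close> on \<open>{0..r0}\<close> have the same sum, for all \<open>d\<close>.
  Taking differences gives palindromicity (\<open>palindrome_iff_partial_sums\<close>).

  For (a), setting \<open>u = 1\<close> identifies the degree \<open>d\<close> part of \<open>S[u]/I\<^sup>h\<close> with \<open>S\<^sub>\<le>\<^sub>d/I\<^sub>\<le>\<^sub>d\<close>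
  (\<open>hilbert_homogenization\<close>), so the Hilbert series times \<open>1 - z\<close> is \<open>\<Sum>\<^sub>i \<delta> i z\<^sup>i\<close>. This is the polynomial that
  defines the h-vector provided that \<open>S[u]/I\<^sup>h\<close> has Krull dimension 1 (\<open>krull_dim_homogenization\<close>). Each
  point of \<open>X\<close> spans a line on which \<open>I\<^sup>h\<close> vanishes, which yields a chain of two primes. For the upper
  bound the finiteness of \<open>K\<close> is decisive: \<open>\<Prod>\<^sub>a (t\<^sub>i - a u)\<close>, with \<open>a\<close> running through \<open>K\<close>, lies in \<open>I\<^sup>h\<close>. So a
  prime above \<open>I\<^sup>h\<close> contains \<open>t\<^sub>i - a\<^sub>i u\<close> for suitable \<open>a\<^sub>i\<close>, and the primes above it are primes of
  \<open>K[z]\<close>.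
\<close>

section \<open>Monomials\<close>

lemma mdeg_superset:
  assumes "finite A" "Poly_Mapping.keys m \<subseteq> A"
  shows "mdeg m = (\<Sum>i\<in>A. Poly_Mapping.lookup m i)"
  unfolding mdeg_def using assms
  by (intro sum.mono_neutral_left) (auto simp: in_keys_iff)

lemma mdeg_zero [simp]: "mdeg 0 = 0"
  by (simp add: mdeg_def)

lemma mdeg_add: "mdeg (a + b) = mdeg a + mdeg b"
proof -
  let ?A = "Poly_Mapping.keys a \<union> Poly_Mapping.keys b"
  have "mdeg (a + b) = (\<Sum>i\<in>?A. Poly_Mapping.lookup (a + b) i)"
    by (intro mdeg_superset) (use keys_add[of a b] in auto)
  also have "\<dots> = mdeg a + mdeg b"
    by (simp add: lookup_add sum.distrib mdeg_superset[of ?A])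
  finally show ?thesis .
qed

lemma mdeg_single [simp]: "mdeg (Poly_Mapping.single i k) = k"
  by (simp add: mdeg_def)

lemma mdeg_eq_0_iff: "mdeg m = 0 \<longleftrightarrow> m = 0"
  by (auto simp: mdeg_def in_keys_iff poly_mapping_eq_iff fun_eq_iff)

lemma lookup_le_mdeg: "Poly_Mapping.lookup m i \<le> mdeg m"
proof (cases "i \<in> Poly_Mapping.keys m")
  case True
  then show ?thesis unfolding mdeg_def by (intro member_le_sum) auto
qed (simp add: in_keys_iff)

lemma zero_in_monomials [simp]: "0 \<in> monomials n"
  by (simp add: monomials_def)

lemma add_in_monomials: "a \<in> monomials n \<Longrightarrow> b \<in> monomials n \<Longrightarrow> a + b \<in> monomials n"
  using keys_add[of a b] by (auto simp: monomials_def)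

lemma single_in_monomials: "i < n \<Longrightarrow> Poly_Mapping.single i k \<in> monomials n"
  by (simp add: monomials_def)

lemma monomials_mono: "n \<le> k \<Longrightarrow> monomials n \<subseteq> monomials k"
  by (auto simp: monomials_def)

lemma finite_monomials_le: "finite {m \<in> monomials n. mdeg m \<le> d}"
proof -
  let ?A = "{m \<in> monomials n. mdeg m \<le> d}"
  let ?f = "\<lambda>m. restrict (Poly_Mapping.lookup m) {..<n}"
  have "?f ` ?A \<subseteq> {..<n} \<rightarrow>\<^sub>E {..d}"
    by (auto intro: le_trans[OF lookup_le_mdeg] split: if_splits)
  then have "finite (?f ` ?A)"
    by (rule finite_subset) (intro finite_PiE, auto)
  moreover have "inj_on ?f ?A"
  proof (rule inj_onI, rule poly_mapping_eqI)
    fix a b i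
    assume ab: "a \<in> ?A" "b \<in> ?A" "?f a = ?f b"
    show "Poly_Mapping.lookup a i = Poly_Mapping.lookup b i"
    proof (cases "i < n")
      case True
      then show ?thesis using fun_cong[OF ab(3), of i] by simp
    next
      case False
      then have "i \<notin> Poly_Mapping.keys a" "i \<notin> Poly_Mapping.keys b"
        using ab by (auto simp: monomials_def)
      then show ?thesis by (simp add: in_keys_iff)
    qed
  qed
  ultimately show ?thesis using finite_imageD by blast
qed

lemma finite_monomials_eq: "finite {m \<in> monomials n. mdeg m = d}"
  by (rule finite_subset[OF _ finite_monomials_le[of n d]]) auto

definition monomial_value :: "(nat \<Rightarrow> 'a::comm_ring_1) \<Rightarrow> monomial \<Rightarrow> 'a" where
  "monomial_value x m = (\<Prod>i\<in>Poly_Mapping.keys m. x i ^ Poly_Mapping.lookup m i)"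

lemma monomial_value_superset:
  assumes "finite A" "Poly_Mapping.keys m \<subseteq> A"
  shows "monomial_value x m = (\<Prod>i\<in>A. x i ^ Poly_Mapping.lookup m i)"
  unfolding monomial_value_def using assms
  by (intro prod.mono_neutral_left) (auto simp: in_keys_iff)

lemma monomial_value_zero [simp]: "monomial_value x 0 = 1"
  by (simp add: monomial_value_def)

lemma monomial_value_add: "monomial_value x (a + b) = monomial_value x a * monomial_value x b"
proof -
  let ?A = "Poly_Mapping.keys a \<union> Poly_Mapping.keys b"
  have "monomial_value x (a + b) = (\<Prod>i\<in>?A. x i ^ Poly_Mapping.lookup (a + b) i)"
    by (intro monomial_value_superset) (use keys_add[of a b] in auto)
  also have "\<dots> = monomial_value x a * monomial_value x b"
    by (simp add: lookup_add power_add prod.distrib monomial_value_superset[of ?A])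
  finally show ?thesis .
qed

lemma monomial_value_single [simp]: "monomial_value x (Poly_Mapping.single i k) = x i ^ k"
  by (simp add: monomial_value_def)

section \<open>Polynomials\<close>

lemma mpoly_sum_singles:
  "(p :: 'a::comm_monoid_add mpoly) = (\<Sum>m\<in>Poly_Mapping.keys p. Poly_Mapping.single m (Poly_Mapping.lookup p m))"
  by (rule poly_mapping_eqI)
    (simp add: lookup_sum lookup_single when_def in_keys_iff)

lemma sum_single_superset:
  fixes p :: "'a::comm_monoid_add mpoly"
  assumes "finite A" "Poly_Mapping.keys p \<subseteq> A"
  shows "p = (\<Sum>m\<in>A. Poly_Mapping.single m (Poly_Mapping.lookup p m))"
  using assms by (subst mpoly_sum_singles, intro sum.mono_neutral_left) (auto simp: in_keys_iff)

lemma keys_diff_subset: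
  "Poly_Mapping.keys (p - q :: 'a::ab_group_add mpoly) \<subseteq> Poly_Mapping.keys p \<union> Poly_Mapping.keys q"
  by (auto simp: in_keys_iff lookup_minus)

lemma keys_sum_subset:
  "Poly_Mapping.keys (\<Sum>i\<in>A. f i :: 'a::comm_monoid_add mpoly) \<subseteq> (\<Union>i\<in>A. Poly_Mapping.keys (f i))"
proof
  fix m assume "m \<in> Poly_Mapping.keys (\<Sum>i\<in>A. f i)"
  then have "(\<Sum>i\<in>A. Poly_Mapping.lookup (f i) m) \<noteq> 0"
    by (simp add: in_keys_iff lookup_sum)
  then obtain i where "i \<in> A" "Poly_Mapping.lookup (f i) m \<noteq> 0"
    using sum.not_neutral_contains_not_neutral by blast
  then show "m \<in> (\<Union>i\<in>A. Poly_Mapping.keys (f i))" by (auto simp: in_keys_iff)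
qed

text \<open>
  The spaces that occur below are all cut out by a condition on the monomials alone, so the closure
  properties are proved once for an arbitrary set of monomials.
\<close>

definition supported :: "monomial set \<Rightarrow> 'a::zero mpoly set" where
  "supported A = {p. Poly_Mapping.keys p \<subseteq> A}"

lemma polys_eq: "polys n = supported (monomials n)"
  by (simp add: polys_def supported_def)

lemma polys_le_eq: "polys_le n d = supported {m \<in> monomials n. int (mdeg m) \<le> d}"
  by (auto simp: polys_le_def polys_def supported_def)

lemma homog_polys_eq: "homog_polys n d = supported {m \<in> monomials n. mdeg m = d}"
  by (auto simp: homog_polys_def polys_def supported_def)

lemma supported_zero: "0 \<in> supported A"
  and supported_add: "p \<in> supported A \<Longrightarrow> q \<in> supported A \<Longrightarrow> p + q \<in> supported A"
  for p q :: "'a::comm_monoid_add mpoly"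
  using keys_add[of p q] by (auto simp: supported_def)

lemma supported_diff: "p \<in> supported A \<Longrightarrow> q \<in> supported A \<Longrightarrow> p - q \<in> supported A"
  for p q :: "'a::ab_group_add mpoly"
  using keys_diff_subset[of p q] by (auto simp: supported_def)

lemma supported_sum: "(\<And>i. i \<in> B \<Longrightarrow> f i \<in> supported A) \<Longrightarrow> (\<Sum>i\<in>B. f i) \<in> supported A"
  for f :: "'b \<Rightarrow> 'a::comm_monoid_add mpoly"
  using keys_sum_subset[of f B] by (fastforce simp: supported_def)

lemma supported_single: "m \<in> A \<Longrightarrow> Poly_Mapping.single m c \<in> supported A"
  by (simp add: supported_def)

lemma supported_mono: "A \<subseteq> B \<Longrightarrow> supported A \<subseteq> supported B"
  by (auto simp: supported_def)

lemma supported_mult: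
  fixes p q :: "'a::comm_ring_1 mpoly"
  assumes "p \<in> supported A" "q \<in> supported B"
    and "\<And>a b. a \<in> A \<Longrightarrow> b \<in> B \<Longrightarrow> a + b \<in> C"
  shows "p * q \<in> supported C"
  using assms keys_mult[of p q] by (fastforce simp: supported_def)

lemma lookup_scale [simp]:
  fixes p :: "'a::comm_ring_1 mpoly"
  shows "Poly_Mapping.lookup (Poly_Mapping.single 0 a * p) m = a * Poly_Mapping.lookup p m"
  by (subst mult_map_scale_conv_mult[symmetric])
    (simp add: Poly_Mapping.map.rep_eq when_def)

lemma supported_scale: "p \<in> supported A \<Longrightarrow> Poly_Mapping.single 0 a * p \<in> supported A"
  for p :: "'a::comm_ring_1 mpoly"
  by (fastforce simp: supported_def in_keys_iff)

lemma lookup_scaled_singles: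
  fixes c :: "monomial \<Rightarrow> 'a::comm_ring_1"
  assumes "finite M" "m \<in> M"
  shows "Poly_Mapping.lookup (\<Sum>k\<in>M. Poly_Mapping.single 0 (c k) * Poly_Mapping.single k 1) m = c m"
  using assms by (simp add: mult_single lookup_sum lookup_single when_def)

lemma zero_in_polys [simp]: "0 \<in> polys n"
  and one_in_polys [simp]: "(1 :: 'a::comm_ring_1 mpoly) \<in> polys n"
  by (auto simp: polys_def)

lemma polys_add: "p \<in> polys n \<Longrightarrow> q \<in> polys n \<Longrightarrow> p + q \<in> polys n"
  for p q :: "'a::comm_ring_1 mpoly"
  by (simp add: polys_eq supported_add)

lemma polys_diff: "p \<in> polys n \<Longrightarrow> q \<in> polys n \<Longrightarrow> p - q \<in> polys n"
  for p q :: "'a::comm_ring_1 mpoly"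
  by (simp add: polys_eq supported_diff)

lemma polys_mult: "p \<in> polys n \<Longrightarrow> q \<in> polys n \<Longrightarrow> p * q \<in> polys n"
  for p q :: "'a::comm_ring_1 mpoly"
  unfolding polys_eq by (rule supported_mult) (auto intro: add_in_monomials)

lemma polys_sum: "(\<And>i. i \<in> B \<Longrightarrow> f i \<in> polys n) \<Longrightarrow> (\<Sum>i\<in>B. f i) \<in> polys n"
  for f :: "'b \<Rightarrow> 'a::comm_ring_1 mpoly"
  by (simp add: polys_eq supported_sum)

lemma polys_prod: "(\<And>i. i \<in> B \<Longrightarrow> f i \<in> polys n) \<Longrightarrow> (\<Prod>i\<in>B. f i) \<in> polys n"
  for f :: "'b \<Rightarrow> 'a::comm_ring_1 mpoly"
  by (induction B rule: infinite_finite_induct) (auto intro: polys_mult)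

lemma polys_single: "m \<in> monomials n \<Longrightarrow> Poly_Mapping.single m c \<in> polys n"
  by (simp add: polys_def)

section \<open>Homomorphisms out of the polynomial ring\<close>

text \<open>
  The universal property of the polynomial ring: a homomorphism \<open>c\<close> on the coefficients and a
  multiplicative map \<open>\<mu>\<close> on the monomials extend to a ring homomorphism. Three instances are used:
  evaluation at a point, setting the last variable to 1, and restriction to a line through the origin.
\<close>

locale mpoly_hom =
  fixes c :: "'a::comm_ring_1 \<Rightarrow> 'b::comm_ring_1" and \<mu> :: "monomial \<Rightarrow> 'b"
  assumes coeff_zero [simp]: "c 0 = 0" and coeff_one [simp]: "c 1 = 1"
    and coeff_add: "c (a + b) = c a + c b" and coeff_mult: "c (a * b) = c a * c b"
    and mono_zero [simp]: "\<mu> 0 = 1" and mono_add: "\<mu> (k + m) = \<mu> k * \<mu> m"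
begin

definition hom :: "'a mpoly \<Rightarrow> 'b" where
  "hom p = (\<Sum>m\<in>Poly_Mapping.keys p. c (Poly_Mapping.lookup p m) * \<mu> m)"

lemma hom_superset:
  assumes "finite A" "Poly_Mapping.keys p \<subseteq> A"
  shows "hom p = (\<Sum>m\<in>A. c (Poly_Mapping.lookup p m) * \<mu> m)"
  unfolding hom_def using assms by (intro sum.mono_neutral_left) (auto simp: in_keys_iff)

lemma hom_add: "hom (p + q) = hom p + hom q"
proof -
  let ?A = "Poly_Mapping.keys p \<union> Poly_Mapping.keys q"
  have "hom (p + q) = (\<Sum>m\<in>?A. c (Poly_Mapping.lookup (p + q) m) * \<mu> m)"
    by (intro hom_superset) (use keys_add[of p q] in auto)
  also have "\<dots> = hom p + hom q"
    by (simp add: lookup_add coeff_add sum.distrib distrib_right hom_superset[of ?A])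
  finally show ?thesis .
qed

lemma hom_zero [simp]: "hom 0 = 0"
  by (simp add: hom_def)

lemma hom_single: "hom (Poly_Mapping.single m a) = c a * \<mu> m"
  by (cases "a = 0") (simp_all add: hom_def)

lemma hom_one [simp]: "hom 1 = 1"
  using hom_single[of 0 1] by simp

lemma hom_diff: "hom (p - q) = hom p - hom q"
  using hom_add[of "p - q" q] by (simp add: algebra_simps)

lemma hom_sum: "hom (\<Sum>i\<in>A. f i) = (\<Sum>i\<in>A. hom (f i))"
  by (induction A rule: infinite_finite_induct) (auto simp: hom_add)

lemma hom_mult: "hom (p * q) = hom p * hom q"
proof -
  have "p * q = (\<Sum>m\<in>Poly_Mapping.keys p. Poly_Mapping.single m (Poly_Mapping.lookup p m)) *
                (\<Sum>k\<in>Poly_Mapping.keys q. Poly_Mapping.single k (Poly_Mapping.lookup q k))"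
    using mpoly_sum_singles[of p] mpoly_sum_singles[of q] by simp
  then have "hom (p * q) = (\<Sum>m\<in>Poly_Mapping.keys p. \<Sum>k\<in>Poly_Mapping.keys q.
       c (Poly_Mapping.lookup p m * Poly_Mapping.lookup q k) * \<mu> (m + k))"
    by (simp add: sum_product mult_single hom_sum hom_single)
  also have "\<dots> = hom p * hom q"
    by (simp add: hom_def sum_product coeff_mult mono_add mult_ac)
  finally show ?thesis .
qed

lemma hom_prod: "hom (\<Prod>i\<in>A. f i) = (\<Prod>i\<in>A. hom (f i))"
  by (induction A rule: infinite_finite_induct) (auto simp: hom_mult)

end

lemma mpoly_hom_eval: "mpoly_hom (\<lambda>a. a) (monomial_value x)"
  by unfold_locales (auto simp: monomial_value_add)

lemma eval_mpoly_eq_hom: "eval_mpoly x = mpoly_hom.hom (\<lambda>a. a) (monomial_value x)"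
  by (rule ext) (simp add: eval_mpoly_def mpoly_hom.hom_def[OF mpoly_hom_eval] monomial_value_def)

lemmas eval_mpoly_add = mpoly_hom.hom_add[OF mpoly_hom_eval, folded eval_mpoly_eq_hom]
  and eval_mpoly_diff = mpoly_hom.hom_diff[OF mpoly_hom_eval, folded eval_mpoly_eq_hom]
  and eval_mpoly_mult = mpoly_hom.hom_mult[OF mpoly_hom_eval, folded eval_mpoly_eq_hom]
  and eval_mpoly_sum = mpoly_hom.hom_sum[OF mpoly_hom_eval, folded eval_mpoly_eq_hom]
  and eval_mpoly_prod = mpoly_hom.hom_prod[OF mpoly_hom_eval, folded eval_mpoly_eq_hom]
  and eval_mpoly_single = mpoly_hom.hom_single[OF mpoly_hom_eval, folded eval_mpoly_eq_hom]
  and eval_mpoly_zero = mpoly_hom.hom_zero[OF mpoly_hom_eval, folded eval_mpoly_eq_hom]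
  and eval_mpoly_one = mpoly_hom.hom_one[OF mpoly_hom_eval, folded eval_mpoly_eq_hom]

section \<open>Ideals of the polynomial ring\<close>

lemma poly_ring_simps [simp]:
  "carrier (poly_ring n) = polys n" "monoid.mult (poly_ring n) = (*)" "one (poly_ring n) = 1"
  "zero (poly_ring n) = 0" "add (poly_ring n) = (+)"
  by (simp_all add: poly_ring_def)

lemma cring_poly_ring: "cring (poly_ring n :: 'a::comm_ring_1 mpoly ring)"
proof (rule cringI)
  show "abelian_group (poly_ring n :: 'a mpoly ring)"
  proof (rule abelian_groupI)
    fix x :: "'a mpoly" assume "x \<in> carrier (poly_ring n)"
    then show "\<exists>y\<in>carrier (poly_ring n). y \<oplus>\<^bsub>poly_ring n\<^esub> x = \<zero>\<^bsub>poly_ring n\<^esub>"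
      using polys_diff[of 0 n x] by (intro bexI[of _ "- x"]) auto
  qed (auto intro: polys_add simp: algebra_simps)
  show "comm_monoid (poly_ring n :: 'a mpoly ring)"
    by unfold_locales (auto intro: polys_mult simp: algebra_simps)
qed (auto simp: algebra_simps)

lemma ideal_poly_ringI:
  assumes "J \<subseteq> polys n" "0 \<in> J" "\<And>p q. p \<in> J \<Longrightarrow> q \<in> J \<Longrightarrow> p + q \<in> J"
    and mult: "\<And>p q. p \<in> J \<Longrightarrow> q \<in> polys n \<Longrightarrow> q * p \<in> J"
  shows "ideal J (poly_ring n :: 'a::comm_ring_1 mpoly ring)"
proof -
  interpret cring "poly_ring n :: 'a mpoly ring" by (rule cring_poly_ring)
  show ?thesis
  proof (rule idealI)
    show "Group.subgroup J (add_monoid (poly_ring n))"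
    proof (rule add.subgroupI)
      fix p assume p: "p \<in> J"
      have "\<ominus>\<^bsub>poly_ring n\<^esub> p = - p"
      proof -
        have "- p \<in> polys n" using polys_diff[of 0 n p] assms(1) p by auto
        then show ?thesis using assms(1) p by (intro minus_equality) auto
      qed
      moreover have "- 1 \<in> (polys n :: 'a mpoly set)" using polys_diff[of 0 n 1] by simp
      ultimately show "\<ominus>\<^bsub>poly_ring n\<^esub> p \<in> J" using mult[OF p, of "- 1"] by simp
    qed (use assms in auto)
  qed (use assms in \<open>auto simp: mult.commute ring_axioms\<close>)
qed

lemma ideal_poly_ringD:
  fixes J :: "'a::comm_ring_1 mpoly set"
  assumes "ideal J (poly_ring n)"
  shows "J \<subseteq> polys n" "0 \<in> J" "p \<in> J \<Longrightarrow> q \<in> J \<Longrightarrow> p + q \<in> J" "p \<in> J \<Longrightarrow> q \<in> J \<Longrightarrow> p - q \<in> J"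
    "p \<in> J \<Longrightarrow> q \<in> polys n \<Longrightarrow> q * p \<in> J" "p \<in> J \<Longrightarrow> q \<in> polys n \<Longrightarrow> p * q \<in> J"
proof -
  interpret ideal J "poly_ring n" by fact
  show *: "J \<subseteq> polys n" "0 \<in> J" using a_subset additive_subgroup.zero_closed[OF additive_subgroup_axioms] by auto
  show add: "p \<in> J \<Longrightarrow> q \<in> J \<Longrightarrow> p + q \<in> J" for p q using additive_subgroup.a_closed[OF additive_subgroup_axioms, of p q] by simp
  show mult: "p \<in> J \<Longrightarrow> q \<in> polys n \<Longrightarrow> q * p \<in> J" for p q using I_l_closed by simp
  then show "p \<in> J \<Longrightarrow> q \<in> polys n \<Longrightarrow> p * q \<in> J" for p q by (simp add: mult.commute)
  have "- 1 \<in> (polys n :: 'a mpoly set)" using polys_diff[of 0 n 1] by simp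
  then show "p \<in> J \<Longrightarrow> q \<in> J \<Longrightarrow> p - q \<in> J" using add[of p "- q"] mult[of q "- 1"] by simp
qed

lemma ideal_poly_ring_sum:
  assumes "ideal J (poly_ring n)" "\<And>i. i \<in> A \<Longrightarrow> f i \<in> J"
  shows "(\<Sum>i\<in>A. f i) \<in> (J :: 'a::comm_ring_1 mpoly set)"
  using assms(2) by (induction A rule: infinite_finite_induct)
    (auto intro: ideal_poly_ringD(2,3)[OF assms(1)])

lemma genideal_poly_ring_ideal:
  "G \<subseteq> polys n \<Longrightarrow> ideal (genideal (poly_ring n) G) (poly_ring n)"
  for G :: "'a::comm_ring_1 mpoly set"
  using ring.genideal_ideal[OF cring.axioms(1)[OF cring_poly_ring], of G n] by simp

lemma genideal_incl: "g \<in> G \<Longrightarrow> g \<in> genideal R G"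
  by (auto simp: genideal_def)

lemma genideal_least: "ideal J R \<Longrightarrow> G \<subseteq> J \<Longrightarrow> genideal R G \<subseteq> J"
  by (auto simp: genideal_def)

section \<open>Dimensions of quotients\<close>

definition lin_subspace :: "'a::field mpoly set \<Rightarrow> bool" where
  "lin_subspace V \<longleftrightarrow> 0 \<in> V \<and> (\<forall>p\<in>V. \<forall>q\<in>V. p + q \<in> V) \<and> (\<forall>p\<in>V. \<forall>a. Poly_Mapping.single 0 a * p \<in> V)"

lemma lin_subspace_uminus: "lin_subspace V \<Longrightarrow> p \<in> V \<Longrightarrow> - p \<in> V"
proof -
  assume "lin_subspace V" "p \<in> V"
  moreover have "- p = Poly_Mapping.single 0 (- 1) * p"
    by (rule poly_mapping_eqI) simp
  ultimately show ?thesis by (auto simp: lin_subspace_def)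
qed

lemma lin_subspace_diff: "lin_subspace V \<Longrightarrow> p \<in> V \<Longrightarrow> q \<in> V \<Longrightarrow> p - q \<in> V"
  using lin_subspace_uminus[of V q] unfolding lin_subspace_def
  by (metis diff_conv_add_uminus)

lemma lin_subspace_sum: "lin_subspace V \<Longrightarrow> (\<And>i. i \<in> A \<Longrightarrow> f i \<in> V) \<Longrightarrow> (\<Sum>i\<in>A. f i) \<in> V"
  by (induction A rule: infinite_finite_induct) (auto simp: lin_subspace_def)

lemma lin_subspace_comb:
  "lin_subspace V \<Longrightarrow> (\<And>i. i \<in> A \<Longrightarrow> b i \<in> V) \<Longrightarrow> (\<Sum>i\<in>A. Poly_Mapping.single 0 (c i) * b i) \<in> V"
  by (rule lin_subspace_sum) (auto simp: lin_subspace_def)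

lemma lin_subspace_supported: "lin_subspace (supported A)"
  by (auto simp: lin_subspace_def intro: supported_zero supported_add supported_scale)

lemma lin_subspace_ideal: "ideal J (poly_ring n) \<Longrightarrow> lin_subspace J"
  by (auto simp: lin_subspace_def intro: ideal_poly_ringD(2,3) ideal_poly_ringD(5)[OF _ _ polys_single])

lemma lin_subspace_Int: "lin_subspace V \<Longrightarrow> lin_subspace W \<Longrightarrow> lin_subspace (V \<inter> W)"
  by (auto simp: lin_subspace_def)

text \<open>
  Each residue class has exactly one coordinate function with respect to \<open>B\<close> and one with respect to
  \<open>B'\<close>, so changing coordinates is an injection between the two sets of coordinate functions. Over a
  finite field these sets have \<open>q\<close> to the power \<open>card B\<close> and \<open>q\<close> to the power \<open>card B'\<close> elements,
  and the cardinalities of the bases can be compared without the theory of dimension.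
\<close>

lemma quotient_basis_card_le:
  fixes V W :: "'a::{field,finite} mpoly set"
  assumes V: "lin_subspace V" and W: "lin_subspace W"
    and B: "quotient_basis V W B" and B': "quotient_basis V W B'"
  shows "card B \<le> card B'"
proof -
  let ?comb = "\<lambda>B c. \<Sum>b\<in>B. Poly_Mapping.single 0 (c b) * (b :: 'a mpoly)"
  let ?C = "\<lambda>B. B \<rightarrow>\<^sub>E (UNIV :: 'a set)"
  have fin: "finite B" "finite B'" using B B' by (auto simp: quotient_basis_def)
  have inV: "?comb B c \<in> V" "?comb B' c \<in> V" for c
    using B B' V by (auto intro!: lin_subspace_comb simp: quotient_basis_def)
  have "\<forall>c. \<exists>c'. c' \<in> ?C B' \<and> ?comb B c - ?comb B' c' \<in> W"
    using B' inV(1) unfolding quotient_basis_def by blast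
  then obtain F where "\<forall>c. F c \<in> ?C B' \<and> ?comb B c - ?comb B' (F c) \<in> W"
    by (rule choice[THEN exE])
  then have F: "\<And>c. F c \<in> ?C B'" "\<And>c. ?comb B c - ?comb B' (F c) \<in> W"
    by simp_all
  have "inj_on F (?C B)"
  proof (rule inj_onI)
    fix c d assume cd: "c \<in> ?C B" "d \<in> ?C B" "F c = F d"
    have "?comb B' (F c) - ?comb B c \<in> W" "?comb B' (F c) - ?comb B d \<in> W"
      using lin_subspace_uminus[OF W F(2)[of c]] lin_subspace_uminus[OF W F(2)[of d]] cd(3) by auto
    moreover have "\<exists>!e. e \<in> ?C B \<and> ?comb B' (F c) - ?comb B e \<in> W"
      using B inV by (auto simp: quotient_basis_def)
    ultimately show "c = d" using cd by blast
  qed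
  then have "card (?C B) \<le> card (?C B')"
    using F(1) fin by (intro card_inj_on_le[of F]) (auto intro!: finite_PiE)
  then have "card (UNIV :: 'a set) ^ card B \<le> card (UNIV :: 'a set) ^ card B'"
    using fin by (simp add: card_PiE)
  moreover have "card (UNIV :: 'a set) > 1"
    using card_mono[OF finite_UNIV, of "{0, 1 :: 'a}"] by simp
  ultimately show ?thesis by (rule power_le_imp_le_exp[rotated])
qed

text \<open>
  The form in which every dimension below is computed: a family \<open>b\<close> that spans modulo \<open>W\<close> and is
  linearly independent modulo \<open>W\<close>.
\<close>

lemma quotient_dim_eqI:
  fixes V W :: "'a::{field,finite} mpoly set" and b :: "'b \<Rightarrow> 'a mpoly"
  assumes V: "lin_subspace V" and W: "lin_subspace W"
    and M: "finite M" "\<And>m. m \<in> M \<Longrightarrow> b m \<in> V"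
    and spans: "\<And>v. v \<in> V \<Longrightarrow> \<exists>c. v - (\<Sum>m\<in>M. Poly_Mapping.single 0 (c m) * b m) \<in> W"
    and indep: "\<And>c m. (\<Sum>m\<in>M. Poly_Mapping.single 0 (c m) * b m) \<in> W \<Longrightarrow> m \<in> M \<Longrightarrow> c m = 0"
  shows "quotient_dim V W = card M"
proof -
  let ?comb = "\<lambda>c. \<Sum>m\<in>M. Poly_Mapping.single 0 (c m) * b m"
  have inj: "inj_on b M"
  proof (rule inj_onI, rule ccontr)
    fix k l assume kl: "k \<in> M" "l \<in> M" "b k = b l" "k \<noteq> l"
    \<comment> \<open>A repeated basis vector gives the relation \<open>b k - b l = 0\<close>.\<close>
    let ?c = "\<lambda>m. (if m = k then 1 else 0) - (if m = l then 1 else 0) :: 'a"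
    have "?comb ?c = (\<Sum>m\<in>M. (if m = k then b m else 0) - (if m = l then b m else 0))"
      by (intro sum.cong) (auto simp: left_diff_distrib single_uminus)
    also have "\<dots> = 0" using kl M(1) by (simp add: sum_subtractf)
    finally have "?c k = 0" using indep[of ?c k] W kl by (auto simp: lin_subspace_def)
    then show False using kl by simp
  qed
  have basis: "quotient_basis V W (b ` M)"
    unfolding quotient_basis_def
  proof (intro conjI ballI)
    fix v assume "v \<in> V"
    then obtain c where c: "v - ?comb c \<in> W" using spans by blast
    define c' where "c' = restrict (\<lambda>x. c (the_inv_into M b x)) (b ` M)"
    have re: "(\<Sum>x\<in>b ` M. Poly_Mapping.single 0 (f x) * x) = ?comb (\<lambda>m. f (b m))" for f
      using inj by (simp add: sum.reindex)
    have "?comb (\<lambda>m. c' (b m)) = ?comb c"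
      using inj by (intro sum.cong) (auto simp: c'_def the_inv_into_f_f)
    then have c': "c' \<in> b ` M \<rightarrow>\<^sub>E UNIV" "v - ?comb (\<lambda>m. c' (b m)) \<in> W"
      using c by (auto simp: c'_def)
    show "\<exists>!c. c \<in> b ` M \<rightarrow>\<^sub>E UNIV \<and> v - (\<Sum>x\<in>b ` M. Poly_Mapping.single 0 (c x) * x) \<in> W"
      unfolding re
    proof (rule ex1I[of _ c'])
      fix d assume d: "d \<in> b ` M \<rightarrow>\<^sub>E UNIV \<and> v - ?comb (\<lambda>m. d (b m)) \<in> W"
      have "?comb (\<lambda>m. d (b m) - c' (b m)) = (v - ?comb (\<lambda>m. c' (b m))) - (v - ?comb (\<lambda>m. d (b m)))"
        by (simp add: single_diff left_diff_distrib sum_subtractf)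
      also have "\<dots> \<in> W" by (rule lin_subspace_diff[OF W c'(2) conjunct2[OF d]])
      finally have "d (b m) - c' (b m) = 0" if "m \<in> M" for m
        by (rule indep[OF _ that])
      then show "d = c'" using d c'(1) by (intro PiE_ext[of d "b ` M" "\<lambda>_. UNIV" c']) auto
    qed (use c' in auto)
  qed (use M in auto)
  show ?thesis unfolding quotient_dim_def
  proof (rule the_equality)
    show "\<exists>B. quotient_basis V W B \<and> card B = card M"
      using basis inj card_image by blast
    fix k assume "\<exists>B. quotient_basis V W B \<and> card B = k"
    then show "k = card M"
      using basis quotient_basis_card_le[OF V W] card_image[OF inj] le_antisym by metis
  qed
qed

section \<open>Separating finitely many points\<close>

lemma ideal_vanishing_ideal: "ideal (vanishing_ideal n X) (poly_ring n)"
  by (rule ideal_poly_ringI)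
    (auto simp: vanishing_ideal_def eval_mpoly_zero eval_mpoly_add eval_mpoly_mult intro: polys_add polys_mult)

text \<open>
  For each \<open>y \<in> Y\<close> choose a coordinate in which \<open>x\<close> and \<open>y\<close> differ; the product of the linear factors
  \<open>(t\<^sub>i - y\<^sub>i) / (x\<^sub>i - y\<^sub>i)\<close> is the required polynomial.
\<close>

lemma separating_polynomial:
  fixes x :: "nat \<Rightarrow> 'a::field"
  assumes "finite Y" "Y \<subseteq> affine_space n" "x \<in> affine_space n" "x \<notin> Y"
  shows "\<exists>f\<in>polys n. eval_mpoly x f = 1 \<and> (\<forall>y\<in>Y. eval_mpoly y f = 0)"
  using assms
proof (induction Y rule: finite_induct)
  case empty
  show ?case by (rule bexI[of _ 1]) (auto simp: eval_mpoly_one)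
next
  case (insert y Y)
  then obtain f where f: "f \<in> polys n" "eval_mpoly x f = 1" "\<forall>y\<in>Y. eval_mpoly y f = 0"
    by auto
  \<comment> \<open>Points are functions that are undefined outside the first \<open>n\<close> indices,
    so distinct points already differ in one of these.\<close>
  have "\<exists>i<n. x i \<noteq> y i"
  proof (rule ccontr)
    assume "\<not> (\<exists>i<n. x i \<noteq> y i)"
    moreover have "x i = y i" if "\<not> i < n" for i
      using insert.prems that unfolding affine_space_def
      by (metis PiE_arb insert_subset lessThan_iff)
    ultimately have "x = y" by auto
    then show False using insert.prems by simp
  qed
  then obtain i where i: "i < n" "x i \<noteq> y i" by blast
  let ?g = "Poly_Mapping.single (var i) 1 - Poly_Mapping.single 0 (y i) :: 'a mpoly"
  let ?c = "Poly_Mapping.single 0 (inverse (x i - y i)) :: 'a mpoly"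
  have g: "eval_mpoly z ?g = z i - y i" for z
    by (simp add: eval_mpoly_diff eval_mpoly_single var_def)
  have c: "eval_mpoly z ?c = inverse (x i - y i)" for z
    by (simp add: eval_mpoly_single)
  have "?c * ?g * f \<in> polys n"
    using i f by (auto intro!: polys_mult polys_diff polys_single single_in_monomials simp: var_def)
  then show ?case using i f
    by (intro bexI[of _ "?c * ?g * f"]) (auto simp: eval_mpoly_mult g c)
qed

lemma polys_bounded_degree:
  assumes "finite F" "F \<subseteq> polys n"
  shows "\<exists>D::nat. F \<subseteq> polys_le n (int D)"
proof -
  have fin: "finite (\<Union>f\<in>F. mdeg ` Poly_Mapping.keys f)" using assms by auto
  define D where "D = Max (\<Union>f\<in>F. mdeg ` Poly_Mapping.keys f)"
  have "mdeg m \<le> D" if "f \<in> F" "m \<in> Poly_Mapping.keys f" for f m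
    unfolding D_def by (rule Max_ge[OF fin]) (use that in blast)
  then have "F \<subseteq> polys_le n (int D)"
    using assms(2) unfolding polys_le_def by auto
  then show ?thesis by blast
qed

text \<open>
  Once \<open>d\<close> bounds the degrees of polynomials \<open>f x\<close> that are 1 at \<open>x\<close> and 0 at the other points, these
  \<open>f x\<close> form a basis of the quotient: modulo the vanishing ideal a polynomial is determined by its
  values on \<open>X\<close>, which are its coordinates.
\<close>

lemma affine_hilbert_eventually_card:
  fixes X :: "(nat \<Rightarrow> 'a::{field,finite}) set"
  assumes X: "finite X" "X \<subseteq> affine_space n"
  shows "\<exists>D::nat. \<forall>d\<ge>int D. affine_hilbert n (vanishing_ideal n X) d = card X"
proof -
  have "\<forall>x\<in>X. \<exists>f. f \<in> polys n \<and> eval_mpoly x f = 1 \<and> (\<forall>y\<in>X - {x}. eval_mpoly y f = 0)"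
  proof
    fix x assume "x \<in> X"
    then show "\<exists>f. f \<in> polys n \<and> eval_mpoly x f = 1 \<and> (\<forall>y\<in>X - {x}. eval_mpoly y f = 0)"
      using separating_polynomial[of "X - {x}" n x] X by (auto simp: Bex_def)
  qed
  from bchoice[OF this] obtain f where "\<forall>x\<in>X. f x \<in> polys n \<and> eval_mpoly x (f x) = 1
      \<and> (\<forall>y\<in>X - {x}. eval_mpoly y (f x) = 0)" ..
  then have f: "\<And>x. x \<in> X \<Longrightarrow> f x \<in> polys n" "\<And>x. x \<in> X \<Longrightarrow> eval_mpoly x (f x) = 1"
    "\<And>x y. x \<in> X \<Longrightarrow> y \<in> X \<Longrightarrow> y \<noteq> x \<Longrightarrow> eval_mpoly y (f x) = 0"
    by auto
  obtain D where D: "f ` X \<subseteq> polys_le n (int D)"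
    using polys_bounded_degree[of "f ` X" n] X f(1) by auto
  let ?I = "vanishing_ideal n X"
  have "affine_hilbert n ?I d = card X" if d: "d \<ge> int D" for d
    unfolding affine_hilbert_def
  proof (rule quotient_dim_eqI[where b = f])
    let ?comb = "\<lambda>c. \<Sum>x\<in>X. Poly_Mapping.single 0 (c x) * f x"
    show sub: "lin_subspace (polys_le n d :: 'a mpoly set)"
      unfolding polys_le_eq by (rule lin_subspace_supported)
    then show "lin_subspace (?I \<inter> polys_le n d)"
      by (intro lin_subspace_Int lin_subspace_ideal[OF ideal_vanishing_ideal])
    show f_le: "f x \<in> polys_le n d" if "x \<in> X" for x
      using D that d by (force simp: polys_le_def)
    have comb: "eval_mpoly y (?comb c) = c y" if "y \<in> X" for c y
    proof -
      have "eval_mpoly y (?comb c) = (\<Sum>x\<in>X. if x = y then c y else 0)"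
        unfolding eval_mpoly_sum using f that
        by (intro sum.cong) (auto simp: eval_mpoly_mult eval_mpoly_single)
      then show ?thesis using X that by simp
    qed
    show "\<exists>c. v - ?comb c \<in> ?I \<inter> polys_le n d" if v: "v \<in> polys_le n d" for v
    proof (rule exI[of _ "\<lambda>x. eval_mpoly x v"])
      have "v - ?comb (\<lambda>x. eval_mpoly x v) \<in> polys_le n d"
        by (intro lin_subspace_diff[OF sub] v lin_subspace_comb[OF sub] f_le)
      then show "v - ?comb (\<lambda>x. eval_mpoly x v) \<in> ?I \<inter> polys_le n d"
        by (auto simp: vanishing_ideal_def polys_le_def eval_mpoly_diff comb)
    qed
    show "c x = 0" if "?comb c \<in> ?I \<inter> polys_le n d" "x \<in> X" for c x
      using that comb[of x c] by (auto simp: vanishing_ideal_def)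
  qed (use X in auto)
  then show ?thesis by blast
qed

section \<open>Graded orders and standard monomials\<close>

locale graded_order =
  fixes n :: nat and r :: "monomial rel"
  assumes graded: "graded_monomial_order n r"
begin

lemma linear: "linear_order_on (monomials n) r"
  and add_mono: "a \<in> monomials n \<Longrightarrow> b \<in> monomials n \<Longrightarrow> c \<in> monomials n \<Longrightarrow> (a, b) \<in> r \<Longrightarrow> (a + c, b + c) \<in> r"
  and mdeg_mono: "a \<in> monomials n \<Longrightarrow> b \<in> monomials n \<Longrightarrow> mdeg a < mdeg b \<Longrightarrow> (a, b) \<in> r"
  using graded by (auto simp: graded_monomial_order_def monomial_order_def)

lemma total: "a \<in> monomials n \<Longrightarrow> b \<in> monomials n \<Longrightarrow> (a, b) \<in> r \<or> (b, a) \<in> r"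
  and refl: "a \<in> monomials n \<Longrightarrow> (a, a) \<in> r"
  and antisym: "(a, b) \<in> r \<Longrightarrow> (b, a) \<in> r \<Longrightarrow> a = b"
  and trans: "(a, b) \<in> r \<Longrightarrow> (b, c) \<in> r \<Longrightarrow> (a, c) \<in> r"
proof -
  have "refl_on (monomials n) r" "antisym r" "Relation.trans r" "total_on (monomials n) r"
    using linear by (auto simp: order_on_defs)
  then show "a \<in> monomials n \<Longrightarrow> b \<in> monomials n \<Longrightarrow> (a, b) \<in> r \<or> (b, a) \<in> r"
    and "a \<in> monomials n \<Longrightarrow> (a, a) \<in> r"
    and "(a, b) \<in> r \<Longrightarrow> (b, a) \<in> r \<Longrightarrow> a = b"
    and "(a, b) \<in> r \<Longrightarrow> (b, c) \<in> r \<Longrightarrow> (a, c) \<in> r"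
    by (metis total_on_def refl_onD, metis refl_onD, metis antisymD, metis transD)
qed

lemma le_mdeg: "a \<in> monomials n \<Longrightarrow> b \<in> monomials n \<Longrightarrow> (a, b) \<in> r \<Longrightarrow> mdeg a \<le> mdeg b"
  using mdeg_mono antisym by (metis leI less_irrefl)

lemma finite_has_greatest:
  assumes "finite A" "A \<noteq> {}" "A \<subseteq> monomials n"
  shows "\<exists>m\<in>A. \<forall>k\<in>A. (k, m) \<in> r"
  using assms
proof (induction A rule: finite_ne_induct)
  case (singleton a)
  then show ?case using refl by auto
next
  case (insert a A)
  then obtain m where m: "m \<in> A" "\<forall>k\<in>A. (k, m) \<in> r" by auto
  show ?case
  proof (cases "(a, m) \<in> r")
    case True
    then show ?thesis using m by auto
  next
    case False
    then have "(m, a) \<in> r" using total insert.prems m by blast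
    then have "\<forall>k\<in>insert a A. (k, a) \<in> r"
      using m trans refl insert.prems by blast
    then show ?thesis by blast
  qed
qed

lemma lead_monomial_eqI:
  assumes "m \<in> Poly_Mapping.keys f" "\<And>k. k \<in> Poly_Mapping.keys f \<Longrightarrow> (k, m) \<in> r"
  shows "lead_monomial r f = m"
  unfolding lead_monomial_def using assms by (intro the_equality) (auto intro: antisym)

lemma lead_monomial:
  assumes "f \<in> polys n" "f \<noteq> 0"
  shows "lead_monomial r f \<in> Poly_Mapping.keys f"
    and "k \<in> Poly_Mapping.keys f \<Longrightarrow> (k, lead_monomial r f) \<in> r"
proof -
  have "Poly_Mapping.keys f \<noteq> {}" using assms(2) by (auto simp: poly_mapping_eq_iff fun_eq_iff in_keys_iff)
  then obtain m where m: "m \<in> Poly_Mapping.keys f" "\<forall>k\<in>Poly_Mapping.keys f. (k, m) \<in> r"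
    using finite_has_greatest[of "Poly_Mapping.keys f"] assms(1) by (auto simp: polys_def)
  then have "lead_monomial r f = m" by (intro lead_monomial_eqI) auto
  then show "lead_monomial r f \<in> Poly_Mapping.keys f"
    and "k \<in> Poly_Mapping.keys f \<Longrightarrow> (k, lead_monomial r f) \<in> r"
    using m by auto
qed

end

locale graded_order_ideal = graded_order n r
  for n :: nat and r :: "monomial rel" +
  fixes I :: "'a::{field,finite} mpoly set"
  assumes ideal: "ideal I (poly_ring n)"
begin

lemmas I_polys = ideal_poly_ringD(1)[OF ideal]

definition leads :: "monomial set" where
  "leads = lead_monomial r ` (I - {0})"

definition standard :: "monomial set" where
  "standard = monomials n - leads"

definition standard_deg :: "nat \<Rightarrow> monomial set" where
  "standard_deg d = {m \<in> standard. mdeg m = d}"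

lemma leads_monomials: "leads \<subseteq> monomials n"
  unfolding leads_def using lead_monomial(1) I_polys by (auto simp: polys_def)

lemma finite_standard_deg: "finite (standard_deg d)"
  by (rule finite_subset[OF _ finite_monomials_eq[of n d]]) (auto simp: standard_deg_def standard_def)

lemma finite_standard_le: "finite {m \<in> standard. mdeg m \<le> d}"
  by (rule finite_subset[OF _ finite_monomials_le[of n d]]) (auto simp: standard_def)

text \<open>
  An ideal is closed under multiplication by a monomial, and a monomial order is compatible with it.
\<close>

lemma leads_add:
  assumes "m \<in> leads" "k \<in> monomials n"
  shows "m + k \<in> leads"
proof -
  obtain f where f: "f \<in> I" "f \<noteq> 0" "m = lead_monomial r f"
    using assms by (auto simp: leads_def)
  have fn: "f \<in> polys n" using f I_polys by auto
  define g where "g = Poly_Mapping.single k 1 * f"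
  have lookup_g: "Poly_Mapping.lookup g (j + k) = Poly_Mapping.lookup f j" for j
  proof -
    have "g = (\<Sum>i\<in>Poly_Mapping.keys f. Poly_Mapping.single (k + i) (Poly_Mapping.lookup f i))"
      unfolding g_def by (subst mpoly_sum_singles[of f]) (simp add: sum_distrib_left mult_single)
    then have "Poly_Mapping.lookup g (j + k)
       = (\<Sum>i\<in>Poly_Mapping.keys f. if i = j then Poly_Mapping.lookup f i else 0)"
      by (simp add: lookup_sum lookup_single when_def add.commute)
    then show ?thesis by (simp add: in_keys_iff)
  qed
  have m: "m \<in> Poly_Mapping.keys f" "m \<in> monomials n"
    using lead_monomial(1)[OF fn f(2)] f fn by (auto simp: polys_def)
  have mg: "m + k \<in> Poly_Mapping.keys g" using m lookup_g by (auto simp: in_keys_iff)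
  have "lead_monomial r g = m + k"
  proof (rule lead_monomial_eqI[OF mg])
    fix j assume "j \<in> Poly_Mapping.keys g"
    then obtain i where i: "i \<in> Poly_Mapping.keys f" "j = i + k"
      using keys_mult[of "Poly_Mapping.single k 1" f] unfolding g_def
      by (auto simp: add.commute)
    then show "(j, m + k) \<in> r"
      using add_mono[of i m k] lead_monomial(2)[OF fn f(2) i(1)] m fn assms f(3)
      by (auto simp: polys_def)
  qed
  moreover have "g \<in> I" unfolding g_def
    using ideal_poly_ringD(5)[OF ideal f(1) polys_single[OF assms(2)]] .
  moreover have "g \<noteq> 0" using mg by auto
  ultimately show ?thesis unfolding leads_def by force
qed

text \<open>
  Since the leading monomials are closed under multiplication by monomials, the initial ideal is just
  their linear span. This makes its Hilbert function and its standard monomials explicit.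
\<close>

lemma initial_ideal_eq: "initial_ideal n r I = supported leads"
proof
  show "initial_ideal n r I \<subseteq> supported leads"
    unfolding initial_ideal_def
  proof (rule genideal_least, rule ideal_poly_ringI)
    fix p q :: "'a mpoly" assume "p \<in> supported leads" "q \<in> polys n"
    then show "q * p \<in> supported leads"
      using supported_mult[of p leads q "monomials n" leads] leads_add
      by (auto simp: polys_eq mult.commute)
  qed (use leads_monomials in \<open>auto simp: polys_eq supported_zero leads_def
         intro: supported_add supported_single dest: supported_mono\<close>)
  have id: "ideal (initial_ideal n r I) (poly_ring n)"
    unfolding initial_ideal_def
    using leads_monomials by (intro genideal_poly_ring_ideal) (auto simp: leads_def intro!: polys_single)
  show "supported leads \<subseteq> initial_ideal n r I"
  proof
    fix p :: "'a mpoly" assume p: "p \<in> supported leads"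
    have "Poly_Mapping.single m (Poly_Mapping.lookup p m) \<in> initial_ideal n r I"
      if m: "m \<in> Poly_Mapping.keys p" for m
    proof -
      have "Poly_Mapping.single m 1 \<in> initial_ideal n r I"
        unfolding initial_ideal_def using p m
        by (intro genideal_incl) (auto simp: supported_def leads_def)
      from ideal_poly_ringD(5)[OF id this polys_single[of 0 n "Poly_Mapping.lookup p m"]]
      show ?thesis by (simp add: mult_single)
    qed
    then show "p \<in> initial_ideal n r I"
      by (subst mpoly_sum_singles) (rule ideal_poly_ring_sum[OF id])
  qed
qed

lemma standard_monomials_eq:
  "standard_monomials n r I = (\<lambda>m. Poly_Mapping.single m 1) ` standard"
  unfolding standard_monomials_def initial_ideal_eq standard_def supported_def by auto

lemma card_standard_monomials:
  "card (standard_monomials n r I \<inter> homog_polys n d) = card (standard_deg d)"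
proof -
  have "standard_monomials n r I \<inter> homog_polys n d
      = (\<lambda>m. Poly_Mapping.single m 1) ` standard_deg d"
    unfolding standard_monomials_eq
    by (auto simp: homog_polys_def standard_deg_def standard_def intro: polys_single)
  moreover have "inj_on (\<lambda>m. Poly_Mapping.single m (1::'a)) (standard_deg d)"
    by (rule inj_onI) (metis keys_single one_neq_zero singleton_inject)
  ultimately show ?thesis by (simp add: card_image)
qed

lemma hilbert_initial_ideal: "hilbert n (initial_ideal n r I) d = card (standard_deg d)"
  unfolding hilbert_def
proof (rule quotient_dim_eqI[where b = "\<lambda>m. Poly_Mapping.single m 1"])
  let ?V = "homog_polys n d :: 'a mpoly set"
  let ?comb = "\<lambda>c :: monomial \<Rightarrow> 'a. \<Sum>m\<in>standard_deg d. Poly_Mapping.single 0 (c m) * Poly_Mapping.single m 1"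
  show sub: "lin_subspace ?V"
    unfolding homog_polys_eq by (rule lin_subspace_supported)
  show "lin_subspace (initial_ideal n r I \<inter> ?V)"
    unfolding initial_ideal_eq by (intro lin_subspace_Int sub lin_subspace_supported)
  show inV: "Poly_Mapping.single m 1 \<in> ?V" if "m \<in> standard_deg d" for m
    using that by (auto simp: standard_deg_def standard_def homog_polys_eq intro: supported_single)
  have comb: "Poly_Mapping.lookup (?comb c) m = c m" if "m \<in> standard_deg d" for c m
    using lookup_scaled_singles[of "standard_deg d" m c] finite_standard_deg that by simp
  show "\<exists>c. v - ?comb c \<in> initial_ideal n r I \<inter> ?V" if v: "v \<in> ?V" for v
  proof (intro exI IntI)
    let ?w = "v - ?comb (Poly_Mapping.lookup v)"
    show w: "?w \<in> ?V"
      by (intro lin_subspace_diff[OF sub v] lin_subspace_comb[OF sub] inV)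
    have keys_w: "Poly_Mapping.keys ?w \<subseteq> {m \<in> monomials n. mdeg m = d}"
      using w unfolding homog_polys_eq supported_def by blast
    have "m \<in> leads" if m: "m \<in> Poly_Mapping.keys ?w" for m
    proof (rule ccontr)
      assume "m \<notin> leads"
      then have "m \<in> standard_deg d"
        using subsetD[OF keys_w m] by (simp add: standard_deg_def standard_def)
      then show False using m comb by (simp add: in_keys_iff lookup_minus)
    qed
    then show "?w \<in> initial_ideal n r I" unfolding initial_ideal_eq by (auto simp: supported_def)
  qed
  show "c m = 0" if c: "?comb c \<in> initial_ideal n r I \<inter> ?V" and m: "m \<in> standard_deg d" for c m
  proof -
    have "m \<notin> Poly_Mapping.keys (?comb c)"
      using c m by (auto simp: initial_ideal_eq supported_def standard_deg_def standard_def)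
    then show ?thesis using comb[OF m] by (simp add: in_keys_iff)
  qed
qed (rule finite_standard_deg)

text \<open>
  Division with remainder by \<open>I\<close>. If the leading monomial of \<open>v\<close> is one of \<open>I\<close>, it is cancelled by a
  multiple of an element of \<open>I\<close>; otherwise it is moved to the remainder. Either way only smaller
  monomials are left. As the order is graded, the elements of \<open>I\<close> used for the cancellation have degree
  at most \<open>d\<close>; this is what relates standard monomials to the affine Hilbert function. The induction is
  on the number of monomials of degree at most \<open>d\<close> lying below some monomial of \<open>v\<close>.
\<close>

lemma reduction:
  assumes "v \<in> polys_le n (int d)"
  shows "\<exists>w \<in> I \<inter> polys_le n (int d). Poly_Mapping.keys (v - w) \<subseteq> standard"
  using assms
proof (induction "card {k \<in> monomials n. mdeg k \<le> d \<and> (\<exists>m\<in>Poly_Mapping.keys v. (k, m) \<in> r)}"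
    arbitrary: v rule: less_induct)
  case less
  let ?V = "polys_le n (int d) :: 'a mpoly set"
  let ?down = "\<lambda>v :: 'a mpoly. {k \<in> monomials n. mdeg k \<le> d \<and> (\<exists>m\<in>Poly_Mapping.keys v. (k, m) \<in> r)}"
  have sub: "lin_subspace ?V" unfolding polys_le_eq by (rule lin_subspace_supported)
  note sub_I = lin_subspace_Int[OF lin_subspace_ideal[OF ideal] sub]
  have v: "v \<in> polys n" using less.prems by (simp add: polys_le_def)
  show ?case
  proof (cases "v = 0")
    case True
    then show ?thesis using sub_I by (intro bexI[of _ 0]) (auto simp: lin_subspace_def)
  next
    case False
    define m where "m = lead_monomial r v"
    have m: "m \<in> Poly_Mapping.keys v" "\<And>k. k \<in> Poly_Mapping.keys v \<Longrightarrow> (k, m) \<in> r"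
      using lead_monomial[OF v False] by (auto simp: m_def)
    have mn: "m \<in> monomials n" "mdeg m \<le> d"
      using m(1) less.prems by (auto simp: polys_le_def polys_def)
    \<comment> \<open>The common part of both cases: subtracting \<open>t\<close> removes the leading monomial \<open>m\<close>
      and creates nothing above it.\<close>
    have step: "\<exists>w \<in> I \<inter> ?V. Poly_Mapping.keys (v - t - w) \<subseteq> standard"
      if t: "t \<in> ?V" "Poly_Mapping.lookup t m = Poly_Mapping.lookup v m"
        "\<And>k. k \<in> Poly_Mapping.keys t \<Longrightarrow> (k, m) \<in> r" for t
    proof (rule less.hyps)
      show vt: "v - t \<in> ?V" by (rule lin_subspace_diff[OF sub less.prems t(1)])
      have below: "(k, m) \<in> r" "k \<noteq> m" if "k \<in> Poly_Mapping.keys (v - t)" for k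
        using keys_diff_subset[of v t] that m t by (auto simp: in_keys_iff lookup_minus)
      have "m \<notin> ?down (v - t)" using below antisym by blast
      moreover have "?down (v - t) \<subseteq> ?down v" using below trans m(1) by blast
      moreover have "m \<in> ?down v" using mn m(1) refl by blast
      ultimately show "card (?down (v - t)) < card (?down v)"
        by (intro psubset_card_mono) (auto intro: finite_subset[OF _ finite_monomials_le[of n d]])
    qed
    show ?thesis
    proof (cases "m \<in> leads")
      case True
      then obtain g where g: "g \<in> I" "g \<noteq> 0" "m = lead_monomial r g" by (auto simp: leads_def)
      have gn: "g \<in> polys n" using g I_polys by auto
      have g_le: "(k, m) \<in> r" if "k \<in> Poly_Mapping.keys g" for k
        using lead_monomial(2)[OF gn g(2) that] g by simp
      have gV: "g \<in> ?V"
        using gn le_mdeg[OF _ mn(1) g_le] mn(2) by (fastforce simp: polys_le_def polys_def)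
      define a where "a = Poly_Mapping.lookup v m / Poly_Mapping.lookup g m"
      define t where "t = Poly_Mapping.single 0 a * g"
      have tIV: "t \<in> I \<inter> ?V"
        unfolding t_def using sub_I g(1) gV by (auto simp: lin_subspace_def)
      have "m \<in> Poly_Mapping.keys g" using lead_monomial(1)[OF gn g(2)] g(3) by simp
      then have "Poly_Mapping.lookup t m = Poly_Mapping.lookup v m"
        by (simp add: t_def a_def in_keys_iff)
      moreover have "(k, m) \<in> r" if "k \<in> Poly_Mapping.keys t" for k
        using that g_le[of k] by (auto simp: t_def in_keys_iff)
      ultimately obtain w where w: "w \<in> I \<inter> ?V" "Poly_Mapping.keys (v - t - w) \<subseteq> standard"
        using step[of t] tIV by blast
      have "t + w \<in> I \<inter> ?V" using sub_I tIV w(1) unfolding lin_subspace_def by blast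
      then show ?thesis using w(2) by (intro bexI[of _ "t + w"]) (auto simp: algebra_simps)
    next
      case False
      define t where "t = Poly_Mapping.single m (Poly_Mapping.lookup v m)"
      have "t \<in> ?V" using mn by (auto simp: t_def polys_le_def intro: polys_single)
      moreover have "(k, m) \<in> r" if "k \<in> Poly_Mapping.keys t" for k
        using that refl[OF mn(1)] by (auto simp: t_def split: if_splits)
      ultimately obtain w where w: "w \<in> I \<inter> ?V" "Poly_Mapping.keys (v - t - w) \<subseteq> standard"
        using step[of t] by (auto simp: t_def)
      have "v - w = (v - t - w) + t" by simp
      then have "Poly_Mapping.keys (v - w) \<subseteq> Poly_Mapping.keys (v - t - w) \<union> Poly_Mapping.keys t"
        using keys_add[of "v - t - w" t] by simp
      then have "Poly_Mapping.keys (v - w) \<subseteq> standard"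
        using w(2) False mn(1) by (auto simp: t_def standard_def split: if_splits)
      then show ?thesis using w(1) by blast
    qed
  qed
qed

text \<open>
  A nonzero element of \<open>I\<close> has its leading monomial among its monomials.
\<close>

lemma standard_zero:
  assumes "w \<in> I" "Poly_Mapping.keys w \<subseteq> standard"
  shows "w = 0"
proof (rule ccontr)
  assume "w \<noteq> 0"
  then have "lead_monomial r w \<in> leads" "lead_monomial r w \<in> Poly_Mapping.keys w"
    using assms(1) I_polys lead_monomial(1)[of w] by (auto simp: leads_def)
  then show False using assms(2) by (auto simp: standard_def)
qed

lemma standard_basis:
  "v \<in> polys_le n (int d) \<Longrightarrow>
     \<exists>c. v - (\<Sum>m | m \<in> standard \<and> mdeg m \<le> d. Poly_Mapping.single 0 (c m) * Poly_Mapping.single m 1)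
       \<in> I \<inter> polys_le n (int d)"
  "(\<Sum>m | m \<in> standard \<and> mdeg m \<le> d. Poly_Mapping.single 0 (c m) * Poly_Mapping.single m 1) \<in> I \<Longrightarrow>
     m \<in> standard \<Longrightarrow> mdeg m \<le> d \<Longrightarrow> c m = 0"
proof -
  let ?M = "{m \<in> standard. mdeg m \<le> d}"
  let ?comb = "\<lambda>c :: monomial \<Rightarrow> 'a. \<Sum>m\<in>?M. Poly_Mapping.single 0 (c m) * Poly_Mapping.single m 1"
  have comb: "?comb c = (\<Sum>m\<in>?M. Poly_Mapping.single m (c m))" for c
    by (simp add: mult_single)
  show "\<exists>c. v - ?comb c \<in> I \<inter> polys_le n (int d)" if v: "v \<in> polys_le n (int d)"
  proof -
    obtain w where w: "w \<in> I \<inter> polys_le n (int d)" "Poly_Mapping.keys (v - w) \<subseteq> standard"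
      using reduction[OF v] by blast
    have "Poly_Mapping.keys (v - w) \<subseteq> ?M"
      using w v keys_diff_subset[of v w] by (fastforce simp: polys_le_def)
    then have "v - w = ?comb (Poly_Mapping.lookup (v - w))"
      unfolding comb by (rule sum_single_superset[OF finite_standard_le])
    then obtain c where "v - w = ?comb c" by blast
    then have "v - ?comb c = w" by (metis diff_diff_eq2 add_diff_cancel_left')
    then show ?thesis using w(1) by (intro exI[of _ c]) (simp only:)
  qed
  show "c m = 0" if "?comb c \<in> I" and m: "m \<in> standard" "mdeg m \<le> d"
  proof -
    have "Poly_Mapping.keys (?comb c) \<subseteq> standard"
      using keys_sum_subset[of "\<lambda>m. Poly_Mapping.single m (c m)" ?M] unfolding comb
      by (fastforce split: if_splits)
    then have "?comb c = 0" using that standard_zero by blast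
    then show ?thesis
      using lookup_scaled_singles[of ?M m c] finite_standard_le m by simp
  qed
qed

lemma affine_hilbert_card_standard:
  "affine_hilbert n I (int d) = card {m \<in> standard. mdeg m \<le> d}"
  unfolding affine_hilbert_def
proof (rule quotient_dim_eqI[where b = "\<lambda>m. Poly_Mapping.single m 1"])
  show sub: "lin_subspace (polys_le n (int d) :: 'a mpoly set)"
    unfolding polys_le_eq by (rule lin_subspace_supported)
  show "lin_subspace (I \<inter> polys_le n (int d))"
    by (intro lin_subspace_Int sub lin_subspace_ideal[OF ideal])
  show "\<exists>c. v - (\<Sum>m | m \<in> standard \<and> mdeg m \<le> d. Poly_Mapping.single 0 (c m) * Poly_Mapping.single m 1)
       \<in> I \<inter> polys_le n (int d)" if "v \<in> polys_le n (int d)" for v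
    using that by (rule standard_basis(1))
  show "c m = 0" if "(\<Sum>m | m \<in> standard \<and> mdeg m \<le> d. Poly_Mapping.single 0 (c m) * Poly_Mapping.single m 1)
       \<in> I \<inter> polys_le n (int d)" "m \<in> {m \<in> standard. mdeg m \<le> d}" for c m
    using that standard_basis(2)[of c d m] by blast
  show "finite {m \<in> standard. mdeg m \<le> d}" by (rule finite_standard_le)
qed (auto simp: standard_def polys_le_def intro: polys_single)

text \<open>
  With \<open>\<delta> i = card (standard_deg i)\<close>, the affine Hilbert function is the sequence of partial sums of
  \<open>\<delta>\<close>, while \<open>\<delta>\<close> itself is the Hilbert function of the initial ideal. This is the link between the
  conditions of the theorem.
\<close>

lemma affine_hilbert_sum: "affine_hilbert n I (int d) = (\<Sum>i\<le>d. card (standard_deg i))"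
proof -
  have "{m \<in> standard. mdeg m \<le> d} = (\<Union>i\<in>{..d}. standard_deg i)"
    by (auto simp: standard_deg_def)
  then show ?thesis
    unfolding affine_hilbert_card_standard
    using finite_standard_deg by (simp only:, subst card_UN_disjoint) (auto simp: standard_deg_def)
qed

end

section \<open>Homogenization\<close>

text \<open>
  The effect on a monomial of setting the variable with index \<open>n\<close> to 1.
\<close>

definition strip_var :: "nat \<Rightarrow> monomial \<Rightarrow> monomial" where
  "strip_var n m = Poly_Mapping.update n 0 m"

lemma lookup_strip_var: "Poly_Mapping.lookup (strip_var n m) i = (if i = n then 0 else Poly_Mapping.lookup m i)"
  by (simp add: strip_var_def lookup_update)

lemma strip_var_zero [simp]: "strip_var n 0 = 0"
  by (rule poly_mapping_eqI) (simp add: lookup_strip_var)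

lemma strip_var_add: "strip_var n (a + b) = strip_var n a + strip_var n b"
  by (rule poly_mapping_eqI) (simp add: lookup_strip_var lookup_add)

lemma strip_var_decomp: "m = strip_var n m + Poly_Mapping.single n (Poly_Mapping.lookup m n)"
  by (rule poly_mapping_eqI) (simp add: lookup_strip_var lookup_add lookup_single when_def)

lemma mdeg_strip_var: "mdeg m = mdeg (strip_var n m) + Poly_Mapping.lookup m n"
  by (subst strip_var_decomp[of m n]) (simp add: mdeg_add)

lemma mdeg_strip_var_le: "mdeg (strip_var n m) \<le> mdeg m"
  by (simp add: mdeg_strip_var[of m n])

lemma strip_var_monomials: "m \<in> monomials (Suc n) \<Longrightarrow> strip_var n m \<in> monomials n"
  by (auto simp: monomials_def strip_var_def keys_update less_Suc_eq)

lemma strip_var_add_power: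
  assumes "m \<in> monomials n"
  shows "strip_var n (m + Poly_Mapping.single n k) = m"
proof (rule poly_mapping_eqI)
  fix i
  have "n \<notin> Poly_Mapping.keys m" using assms by (auto simp: monomials_def)
  then show "Poly_Mapping.lookup (strip_var n (m + Poly_Mapping.single n k)) i = Poly_Mapping.lookup m i"
    by (auto simp: lookup_strip_var lookup_add lookup_single in_keys_iff)
qed

lemma mpoly_hom_dehomogenize:
  "mpoly_hom (Poly_Mapping.single 0) (\<lambda>m. Poly_Mapping.single (strip_var n m) 1)"
  by unfold_locales (auto simp: single_add mult_single strip_var_add)

definition dehomogenize :: "nat \<Rightarrow> 'a::comm_ring_1 mpoly \<Rightarrow> 'a mpoly" where
  "dehomogenize n = mpoly_hom.hom (Poly_Mapping.single 0) (\<lambda>m. Poly_Mapping.single (strip_var n m) 1)"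

lemmas dehomogenize_add = mpoly_hom.hom_add[OF mpoly_hom_dehomogenize, folded dehomogenize_def]
  and dehomogenize_diff = mpoly_hom.hom_diff[OF mpoly_hom_dehomogenize, folded dehomogenize_def]
  and dehomogenize_mult = mpoly_hom.hom_mult[OF mpoly_hom_dehomogenize, folded dehomogenize_def]
  and dehomogenize_sum = mpoly_hom.hom_sum[OF mpoly_hom_dehomogenize, folded dehomogenize_def]
  and dehomogenize_prod = mpoly_hom.hom_prod[OF mpoly_hom_dehomogenize, folded dehomogenize_def]
  and dehomogenize_zero = mpoly_hom.hom_zero[OF mpoly_hom_dehomogenize, folded dehomogenize_def]

lemma dehomogenize_single:
  "dehomogenize n (Poly_Mapping.single m a) = Poly_Mapping.single (strip_var n m) a"
  unfolding dehomogenize_def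
  by (simp add: mpoly_hom.hom_single[OF mpoly_hom_dehomogenize] mult_single)

lemma dehomogenize_eq_sum:
  "dehomogenize n f = (\<Sum>m\<in>Poly_Mapping.keys f. Poly_Mapping.single (strip_var n m) (Poly_Mapping.lookup f m))"
  by (subst mpoly_sum_singles[of f]) (simp add: dehomogenize_sum dehomogenize_single)

lemma dehomogenize_polys: "f \<in> polys (Suc n) \<Longrightarrow> dehomogenize n f \<in> polys n"
  unfolding dehomogenize_eq_sum
  by (intro polys_sum polys_single strip_var_monomials) (auto simp: polys_def)

lemma dehomogenize_homog_polys: "f \<in> homog_polys (Suc n) d \<Longrightarrow> dehomogenize n f \<in> polys_le n (int d)"
  unfolding dehomogenize_eq_sum polys_le_eq
  by (intro supported_sum supported_single)
    (auto simp: homog_polys_def polys_def mdeg_strip_var_le intro: strip_var_monomials)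

text \<open>
  Homogenization to a prescribed degree \<open>d\<close>. Unlike homogenization to the degree of \<open>f\<close> itself, it is
  additive in \<open>f\<close>, and it is inverse to dehomogenization on the forms of degree \<open>d\<close>.
\<close>

definition homogenize_to :: "nat \<Rightarrow> nat \<Rightarrow> 'a::comm_ring_1 mpoly \<Rightarrow> 'a mpoly" where
  "homogenize_to n d f = (\<Sum>m\<in>Poly_Mapping.keys f.
     Poly_Mapping.single (m + Poly_Mapping.single n (d - mdeg m)) (Poly_Mapping.lookup f m))"

lemma homogenize_eq: "homogenize n f = homogenize_to n (total_deg f) f"
  by (simp add: homogenize_def homogenize_to_def)

lemma homogenize_to_superset:
  assumes "finite A" "Poly_Mapping.keys f \<subseteq> A"
  shows "homogenize_to n d f = (\<Sum>m\<in>A.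
     Poly_Mapping.single (m + Poly_Mapping.single n (d - mdeg m)) (Poly_Mapping.lookup f m))"
  unfolding homogenize_to_def using assms by (intro sum.mono_neutral_left) (auto simp: in_keys_iff)

lemma homogenize_to_add: "homogenize_to n d (f + g) = homogenize_to n d f + homogenize_to n d g"
proof -
  let ?A = "Poly_Mapping.keys f \<union> Poly_Mapping.keys g"
  have "homogenize_to n d (f + g) = (\<Sum>m\<in>?A.
     Poly_Mapping.single (m + Poly_Mapping.single n (d - mdeg m)) (Poly_Mapping.lookup (f + g) m))"
    by (intro homogenize_to_superset) (use keys_add[of f g] in auto)
  also have "\<dots> = homogenize_to n d f + homogenize_to n d g"
    by (simp add: lookup_add single_add sum.distrib homogenize_to_superset[of ?A])
  finally show ?thesis .
qed

lemma homogenize_to_sum: "homogenize_to n d (\<Sum>i\<in>A. f i) = (\<Sum>i\<in>A. homogenize_to n d (f i))"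
  by (induction A rule: infinite_finite_induct) (auto simp: homogenize_to_add, auto simp: homogenize_to_def)

lemma homogenize_to_single:
  "homogenize_to n d (Poly_Mapping.single m a) = Poly_Mapping.single (m + Poly_Mapping.single n (d - mdeg m)) a"
  by (cases "a = 0") (auto simp: homogenize_to_def)

lemma dehomogenize_homogenize_to: "f \<in> polys n \<Longrightarrow> dehomogenize n (homogenize_to n d f) = f"
  unfolding homogenize_to_def
  by (subst (3) mpoly_sum_singles)
    (auto simp: dehomogenize_sum dehomogenize_single strip_var_add_power polys_def subset_iff intro!: sum.cong)

lemma homogenize_to_dehomogenize:
  assumes "f \<in> homog_polys (Suc n) d"
  shows "homogenize_to n d (dehomogenize n f) = f"
proof -
  have "strip_var n m + Poly_Mapping.single n (d - mdeg (strip_var n m)) = m"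
    if "m \<in> Poly_Mapping.keys f" for m
    using assms that mdeg_strip_var[of m n] strip_var_decomp[of m n] by (auto simp: homog_polys_def)
  then show ?thesis
    unfolding dehomogenize_eq_sum homogenize_to_sum homogenize_to_single
    by (subst (4) mpoly_sum_singles) (intro sum.cong, auto)
qed

lemma homogenize_to_mono:
  assumes "\<And>m. m \<in> Poly_Mapping.keys f \<Longrightarrow> mdeg m \<le> e" "e \<le> d"
  shows "homogenize_to n d f = Poly_Mapping.single (Poly_Mapping.single n (d - e)) 1 * homogenize_to n e f"
proof -
  have "Poly_Mapping.single n (d - e) + (m + Poly_Mapping.single n (e - mdeg m)) =
      m + Poly_Mapping.single n (d - mdeg m)" if "m \<in> Poly_Mapping.keys f" for m
  proof -
    have "d - mdeg m = (d - e) + (e - mdeg m)" using assms(1)[OF that] assms(2) by simp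
    then show ?thesis by (simp add: single_add add_ac)
  qed
  then show ?thesis
    by (simp add: homogenize_to_def sum_distrib_left mult_single)
qed

lemma mdeg_le_total_deg: "m \<in> Poly_Mapping.keys f \<Longrightarrow> mdeg m \<le> total_deg f"
  by (auto simp: total_deg_def)

lemma homogenize_to_polys: "f \<in> polys n \<Longrightarrow> homogenize_to n d f \<in> polys (Suc n)"
  unfolding homogenize_to_def using monomials_mono[of n "Suc n"]
  by (intro polys_sum polys_single add_in_monomials single_in_monomials) (auto simp: polys_def)

context
  fixes n :: nat and I :: "'a::comm_ring_1 mpoly set"
  assumes I: "ideal I (poly_ring n)"
begin

lemma ideal_homogenization: "ideal (homogenization n I) (poly_ring (Suc n))"
  unfolding homogenization_def
  by (intro genideal_poly_ring_ideal) (use ideal_poly_ringD(1)[OF I] in \<open>auto simp: homogenize_eq intro!: homogenize_to_polys\<close>)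

lemma dehomogenize_homogenization:
  assumes "f \<in> homogenization n I"
  shows "dehomogenize n f \<in> I"
proof -
  have "homogenization n I \<subseteq> {f \<in> polys (Suc n). dehomogenize n f \<in> I}"
    unfolding homogenization_def
  proof (rule genideal_least, rule ideal_poly_ringI)
    show "homogenize n ` I \<subseteq> {f \<in> polys (Suc n). dehomogenize n f \<in> I}"
      using ideal_poly_ringD(1)[OF I]
      by (auto simp: homogenize_eq dehomogenize_homogenize_to subset_iff intro!: homogenize_to_polys)
  qed (auto simp: dehomogenize_zero dehomogenize_add dehomogenize_mult
         intro: polys_add polys_mult dehomogenize_polys ideal_poly_ringD[OF I])
  then show ?thesis using assms by blast
qed

text \<open>
  A form \<open>f\<close> of degree \<open>d\<close> is the homogenization of \<open>f(t,1)\<close> times the power of \<open>u\<close> that makes up the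
  difference between \<open>d\<close> and the degree of \<open>f(t,1)\<close>. Together with the preceding lemma this says that
  a form lies in \<open>I\<^sup>h\<close> exactly if its dehomogenization lies in \<open>I\<close>.
\<close>

lemma mem_homogenizationI:
  assumes f: "f \<in> homog_polys (Suc n) d" and g: "dehomogenize n f \<in> I"
  shows "f \<in> homogenization n I"
proof -
  let ?g = "dehomogenize n f"
  have le: "total_deg ?g \<le> d"
    using dehomogenize_homog_polys[OF f] by (auto simp: total_deg_def polys_le_def)
  have "f = homogenize_to n d ?g" using homogenize_to_dehomogenize[OF f] by simp
  also have "\<dots> = Poly_Mapping.single (Poly_Mapping.single n (d - total_deg ?g)) 1 * homogenize n ?g"
    unfolding homogenize_eq by (rule homogenize_to_mono[OF mdeg_le_total_deg le])
  also have "\<dots> \<in> homogenization n I"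
  proof (rule ideal_poly_ringD(5)[OF ideal_homogenization])
    show "homogenize n ?g \<in> homogenization n I"
      unfolding homogenization_def using g by (intro genideal_incl) auto
  qed (auto intro!: polys_single single_in_monomials)
  finally show ?thesis .
qed

end

context graded_order_ideal
begin

text \<open>
  Setting \<open>u = 1\<close> identifies the forms of degree \<open>d\<close> modulo \<open>I\<^sup>h\<close> with the polynomials of degree at most
  \<open>d\<close> modulo \<open>I\<close>. Concretely, the standard monomials of degree at most \<open>d\<close>, filled up to degree \<open>d\<close> by
  powers of \<open>u\<close>, form a basis.
\<close>

lemma hilbert_homogenization:
  "hilbert (Suc n) (homogenization n I) d = affine_hilbert n I (int d)"
  unfolding hilbert_def affine_hilbert_card_standard
proof (rule quotient_dim_eqI[where b = "\<lambda>m. Poly_Mapping.single (m + Poly_Mapping.single n (d - mdeg m)) 1"])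
  let ?M = "{m \<in> standard. mdeg m \<le> d}"
  let ?V = "homog_polys (Suc n) d :: 'a mpoly set"
  let ?b = "\<lambda>m. Poly_Mapping.single (m + Poly_Mapping.single n (d - mdeg m)) (1::'a)"
  let ?comb = "\<lambda>c. \<Sum>m\<in>?M. Poly_Mapping.single 0 (c m) * ?b m"
  show sub: "lin_subspace ?V"
    unfolding homog_polys_eq by (rule lin_subspace_supported)
  show "lin_subspace (homogenization n I \<inter> ?V)"
    by (intro lin_subspace_Int sub lin_subspace_ideal[OF ideal_homogenization[OF ideal]])
  show bV: "?b m \<in> ?V" if "m \<in> ?M" for m
    using that monomials_mono[of n "Suc n"] unfolding homog_polys_eq
    by (intro supported_single) (auto simp: standard_def mdeg_add intro!: add_in_monomials single_in_monomials)
  have comb: "dehomogenize n (?comb c) = (\<Sum>m\<in>?M. Poly_Mapping.single 0 (c m) * Poly_Mapping.single m 1)" for c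
    by (auto simp: dehomogenize_sum dehomogenize_mult dehomogenize_single strip_var_add_power standard_def
        intro!: sum.cong)
  show "\<exists>c. v - ?comb c \<in> homogenization n I \<inter> ?V" if v: "v \<in> ?V" for v
  proof -
    obtain c where c: "dehomogenize n v - (\<Sum>m\<in>?M. Poly_Mapping.single 0 (c m) * Poly_Mapping.single m 1) \<in> I"
      using standard_basis(1)[OF dehomogenize_homog_polys[OF v]] by blast
    have V: "v - ?comb c \<in> ?V"
      by (rule lin_subspace_diff[OF sub v lin_subspace_comb[OF sub bV]])
    moreover have "dehomogenize n (v - ?comb c) \<in> I"
      unfolding dehomogenize_diff comb by (rule c)
    ultimately show ?thesis using mem_homogenizationI[OF ideal] by blast
  qed
  show "c m = 0" if c: "?comb c \<in> homogenization n I \<inter> ?V" and m: "m \<in> ?M" for c m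
  proof -
    have "dehomogenize n (?comb c) \<in> I" by (rule dehomogenize_homogenization[OF ideal IntD1[OF c]])
    then show ?thesis using standard_basis(2)[of c d m] m unfolding comb by blast
  qed
qed (rule finite_standard_le)

end

section \<open>The Krull dimension of the homogenized quotient\<close>

lemma (in cring) primeideal_quotient_image:
  assumes I: "ideal I R" and P: "primeideal P R" and sub: "I \<subseteq> P"
  shows "primeideal ((+>) I ` P) (R Quot I)"
proof -
  interpret I: ideal I R by fact
  interpret P: primeideal P R by fact
  let ?M = "(+>) I ` P"
  have M: "ideal ?M (R Quot I)"
    by (rule ring_ideal_imp_quot_ideal[OF I P.ideal_axioms])
  have carr: "?M \<subseteq> carrier (R Quot I)"
    using ideal.Icarr[OF M] by blast
  have mem: "I +> a \<in> ?M \<longleftrightarrow> a \<in> P" if "a \<in> carrier R" for a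
  proof -
    have "P = \<Union>?M" using ideal_incl_iff[OF I P.ideal_axioms] sub by simp
    then show ?thesis using canonical_proj_vimage_mem_iff[OF I carr that] by metis
  qed
  show ?thesis
  proof (rule primeidealI[OF M I.quotient_is_cring[OF is_cring]])
    have "I +> \<one> \<notin> ?M" using mem[of \<one>] P.one_imp_carrier P.I_notcarr by auto
    moreover have "I +> \<one> \<in> carrier (R Quot I)"
      using ring_hom_closed[OF I.rcos_ring_hom one_closed] .
    ultimately show "carrier (R Quot I) \<noteq> ?M" by metis
  next
    fix A B assume AB: "A \<in> carrier (R Quot I)" "B \<in> carrier (R Quot I)" "A \<otimes>\<^bsub>R Quot I\<^esub> B \<in> ?M"
    obtain a b where ab: "a \<in> carrier R" "A = I +> a" "b \<in> carrier R" "B = I +> b"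
      using AB(1,2) unfolding FactRing_def using A_RCOSETS_def'[of R I] by auto
    have "A \<otimes>\<^bsub>R Quot I\<^esub> B = I +> (a \<otimes> b)"
      using ab by (simp add: FactRing_def I.rcoset_mult_add)
    then have "a \<otimes> b \<in> P" using AB(3) mem ab by simp
    then show "A \<in> ?M \<or> B \<in> ?M" using P.I_prime ab by blast
  qed
qed

text \<open>
  Prime ideals of \<open>R/I\<close> correspond to prime ideals of \<open>R\<close> above \<open>I\<close>. Preimages under the projection
  turn a chain of length 2 in the quotient into one in \<open>R\<close>, and images turn \<open>P \<subset> Q\<close> into a chain of
  length 1 in the quotient.
\<close>

lemma (in cring) krull_dim_quotient_eq_1:
  assumes I: "ideal I R"
    and chain: "primeideal P R" "primeideal Q R" "I \<subseteq> P" "P \<subset> Q"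
    and no_chain: "\<And>A B C. primeideal A R \<Longrightarrow> primeideal B R \<Longrightarrow> primeideal C R \<Longrightarrow>
      I \<subseteq> A \<Longrightarrow> A \<subset> B \<Longrightarrow> B \<subset> C \<Longrightarrow> False"
  shows "krull_dim (R Quot I) = enat 1"
proof -
  interpret I: ideal I R by fact
  interpret hom: ring_hom_ring R "R Quot I" "(+>) I" by (rule I.rcos_ring_hom_ring)
  let ?chain = "\<lambda>k P. (\<forall>i\<le>k. primeideal (P i) (R Quot I)) \<and> (\<forall>i<k. P i \<subset> P (Suc i))"
  have upper: "k \<le> 1" if "?chain k J" for k :: nat and J
  proof (rule ccontr)
    assume "\<not> k \<le> 1"
    then have k: "2 \<le> k" by simp
    let ?pre = "\<lambda>i. {a \<in> carrier R. I +> a \<in> J i}"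
    have prime: "primeideal (?pre i) R" if "i \<le> 2" for i
      using hom.primeideal_vimage[OF is_cring, of "J i"] \<open>?chain k J\<close> k that by simp
    have strict: "?pre i \<subset> ?pre (Suc i)" if "i < 2" for i
    proof -
      have J: "J i \<subset> J (Suc i)" "ideal (J (Suc i)) (R Quot I)"
        using \<open>?chain k J\<close> k that by (auto simp: primeideal_def)
      then obtain A where A: "A \<in> J (Suc i)" "A \<notin> J i" by blast
      then have "A \<in> carrier (R Quot I)" using ideal.Icarr[OF J(2)] by simp
      then obtain a where "a \<in> carrier R" "A = I +> a"
        unfolding FactRing_def using A_RCOSETS_def'[of R I] by auto
      then show ?thesis using A J by blast
    qed
    have "I \<subseteq> ?pre 0"
    proof
      fix a assume a: "a \<in> I"
      have "primeideal (J 0) (R Quot I)" using \<open>?chain k J\<close> by simp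
      then have "ideal (J 0) (R Quot I)" by (simp add: primeideal_def)
      then have "\<zero>\<^bsub>R Quot I\<^esub> \<in> J 0"
        using additive_subgroup.zero_closed[OF ideal.axioms(1)] by blast
      moreover have "\<zero>\<^bsub>R Quot I\<^esub> = I" unfolding FactRing_def by simp
      ultimately have "I +> a \<in> J 0" using I.a_rcos_const[OF a] by metis
      then show "a \<in> ?pre 0" using I.Icarr[OF a] by blast
    qed
    moreover have "?pre 0 \<subset> ?pre 1" "?pre 1 \<subset> ?pre 2"
      using strict[of 0] strict[of 1] by (simp_all only: One_nat_def numeral_2_eq_2 zero_less_Suc lessI)
    moreover have "primeideal (?pre 0) R" "primeideal (?pre 1) R" "primeideal (?pre 2) R"
      by (rule prime; simp)+
    ultimately show False by (rule no_chain[rotated 3])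
  qed
  define J where "J i = (+>) I ` (if i = (0::nat) then P else Q)" for i
  have IQ: "I \<subseteq> Q" using chain by blast
  have J_prime: "\<forall>i\<le>1. primeideal (J i) (R Quot I)"
    using primeideal_quotient_image[OF I chain(1,3)] primeideal_quotient_image[OF I chain(2) IQ]
    by (simp add: J_def)
  have bij: "inj_on (\<lambda>J. (+>) I ` J) {J. ideal J R \<and> I \<subseteq> J}"
    using quot_ideal_correspondence[OF I] by (simp add: bij_betw_def)
  have "J 0 \<noteq> J 1"
  proof
    assume "J 0 = J 1"
    then have "P = Q" using chain IQ
      by (intro inj_onD[OF bij]) (auto simp: J_def primeideal_def)
    then show False using chain by simp
  qed
  moreover have "J 0 \<subseteq> J 1" using chain by (auto simp: J_def)
  ultimately have "?chain 1 J" using J_prime by auto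
  then have "\<exists>P. ?chain 1 P" by blast
  show ?thesis unfolding krull_dim_def
  proof (rule antisym)
    show "Sup {enat k |k. \<exists>P. ?chain k P} \<le> enat 1"
      using upper by (intro Sup_least) auto
    show "enat 1 \<le> Sup {enat k |k. \<exists>P. ?chain k P}"
      using \<open>\<exists>P. ?chain 1 P\<close> by (intro Sup_upper) blast
  qed
qed

lemma mpoly_hom_line:
  "mpoly_hom (\<lambda>a :: 'a::comm_ring_1. [:a:]) (\<lambda>m. monom (monomial_value x m) (mdeg m))"
  by unfold_locales (auto simp: mult_monom mdeg_add monomial_value_add monom_0 one_pCons)

text \<open>
  The restriction of a polynomial to the line through the origin and \<open>x\<close>, that is, the substitution
  \<open>t\<^sub>i \<mapsto> x\<^sub>i z\<close> into \<open>K[z]\<close>. Below, \<open>x\<close> always has the value 1 at the index of \<open>u\<close>, so \<open>u \<mapsto> z\<close>.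
\<close>

definition line_hom :: "(nat \<Rightarrow> 'a::comm_ring_1) \<Rightarrow> 'a mpoly \<Rightarrow> 'a poly" where
  "line_hom x = mpoly_hom.hom (\<lambda>a. [:a:]) (\<lambda>m. monom (monomial_value x m) (mdeg m))"

lemmas line_hom_add = mpoly_hom.hom_add[OF mpoly_hom_line, folded line_hom_def]
  and line_hom_diff = mpoly_hom.hom_diff[OF mpoly_hom_line, folded line_hom_def]
  and line_hom_mult = mpoly_hom.hom_mult[OF mpoly_hom_line, folded line_hom_def]
  and line_hom_sum = mpoly_hom.hom_sum[OF mpoly_hom_line, folded line_hom_def]
  and line_hom_zero = mpoly_hom.hom_zero[OF mpoly_hom_line, folded line_hom_def]
  and line_hom_one = mpoly_hom.hom_one[OF mpoly_hom_line, folded line_hom_def]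

lemma line_hom_single:
  "line_hom x (Poly_Mapping.single m a) = monom (a * monomial_value x m) (mdeg m)"
  unfolding line_hom_def by (simp add: mpoly_hom.hom_single[OF mpoly_hom_line] smult_monom)

lemma line_hom_eq_sum:
  "line_hom x f = (\<Sum>m\<in>Poly_Mapping.keys f. monom (Poly_Mapping.lookup f m * monomial_value x m) (mdeg m))"
  by (subst mpoly_sum_singles[of f]) (simp add: line_hom_sum line_hom_single)

lemma line_hom_surj:
  fixes x :: "nat \<Rightarrow> 'a::comm_ring_1"
  assumes "x n = 1"
  shows "\<exists>f\<in>polys (Suc n). line_hom x f = g"
proof (rule bexI[of _ "\<Sum>i\<le>degree g. Poly_Mapping.single (Poly_Mapping.single n i) (coeff g i)"])
  show "line_hom x (\<Sum>i\<le>degree g. Poly_Mapping.single (Poly_Mapping.single n i) (coeff g i)) = g"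
    using poly_as_sum_of_monoms[of g] assms by (simp add: line_hom_sum line_hom_single)
qed (auto intro!: polys_sum polys_single single_in_monomials)

text \<open>
  The hypotheses say that \<open>T\<close> is a prime ideal of \<open>K[z]\<close>, stated on the type of univariate polynomials.
\<close>

lemma primeideal_line_preimage:
  fixes x :: "nat \<Rightarrow> 'a::field"
  assumes "0 \<in> T" "\<And>p q. p \<in> T \<Longrightarrow> q \<in> T \<Longrightarrow> p + q \<in> T" "\<And>p q. p \<in> T \<Longrightarrow> q * p \<in> T"
    and "1 \<notin> T" "\<And>p q. p * q \<in> T \<Longrightarrow> p \<in> T \<or> q \<in> T"
  shows "primeideal {f \<in> polys n. line_hom x f \<in> T} (poly_ring n)"
proof (rule primeidealI[OF ideal_poly_ringI cring_poly_ring])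
  show "carrier (poly_ring n) \<noteq> {f \<in> polys n. line_hom x f \<in> T}"
  proof
    assume "carrier (poly_ring n) = {f \<in> polys n. line_hom x f \<in> T}"
    then have "1 \<in> {f \<in> polys n. line_hom x f \<in> T}" using one_in_polys[of n] by simp
    then show False using assms(4) by (simp add: line_hom_one)
  qed
qed (use assms in \<open>auto simp: line_hom_zero line_hom_add line_hom_mult intro: polys_add polys_mult\<close>)

lemma primeideal_prod_mem:
  fixes Q :: "'a::comm_ring_1 mpoly set"
  assumes Q: "primeideal Q (poly_ring n)" and "finite A" "\<And>i. i \<in> A \<Longrightarrow> f i \<in> polys n" "(\<Prod>i\<in>A. f i) \<in> Q"
  shows "\<exists>i\<in>A. f i \<in> Q"
  using assms(2-4)
proof (induction A rule: finite_induct)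
  case empty
  interpret primeideal Q "poly_ring n" by fact
  show ?case using empty one_imp_carrier I_notcarr by simp
next
  case (insert i A)
  interpret primeideal Q "poly_ring n" by fact
  have "f i \<in> Q \<or> (\<Prod>i\<in>A. f i) \<in> Q"
    using I_prime[of "f i" "\<Prod>i\<in>A. f i"] insert by (auto intro: polys_prod)
  then show ?case using insert by auto
qed

text \<open>
  The form \<open>t\<^sub>i - a u\<close>. For \<open>i = n\<close> and \<open>a = 1\<close> it is 0, which allows \<open>u\<close> to be treated like the other
  variables.
\<close>

definition linear_form :: "nat \<Rightarrow> nat \<Rightarrow> 'a::comm_ring_1 \<Rightarrow> 'a mpoly" where
  "linear_form n i a = Poly_Mapping.single (var i) 1 - Poly_Mapping.single (var n) a"

lemma linear_form_polys: "i \<le> n \<Longrightarrow> linear_form n i a \<in> polys (Suc n)"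
  by (auto simp: linear_form_def var_def intro!: polys_diff polys_single single_in_monomials)

text \<open>
  Modulo the forms \<open>t\<^sub>i - x\<^sub>i u\<close> every variable may be replaced by a multiple of \<open>u\<close>.
\<close>

lemma monomial_mod_linear_forms:
  fixes Q :: "'a::comm_ring_1 mpoly set"
  assumes Q: "ideal Q (poly_ring (Suc n))" and x: "\<And>i. i \<le> n \<Longrightarrow> linear_form n i (x i) \<in> Q"
    and "m \<in> monomials (Suc n)"
  shows "Poly_Mapping.single m 1 - Poly_Mapping.single (Poly_Mapping.single n (mdeg m)) (monomial_value x m) \<in> Q"
  using assms(3)
proof (induction "mdeg m" arbitrary: m)
  case 0
  then have "m = 0" by (simp add: mdeg_eq_0_iff)
  then show ?case using ideal_poly_ringD(2)[OF Q] by simp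
next
  case (Suc d)
  have "m \<noteq> 0" using Suc(2) by auto
  then obtain i where i: "i \<in> Poly_Mapping.keys m"
    by (auto simp: poly_mapping_eq_iff fun_eq_iff in_keys_iff)
  define k where "k = Poly_Mapping.update i (Poly_Mapping.lookup m i - 1) m"
  have m: "m = var i + k"
    using i by (intro poly_mapping_eqI) (auto simp: k_def var_def lookup_add lookup_update lookup_single in_keys_iff)
  have k: "k \<in> monomials (Suc n)" and i_le: "i \<le> n"
    using Suc(3) i by (auto simp: k_def monomials_def keys_update)
  have dk: "d = mdeg k" using Suc(2) by (simp add: m mdeg_add var_def)
  let ?a = "Poly_Mapping.single (var i) (1::'a)" and ?b = "Poly_Mapping.single k (1::'a)"
  let ?a' = "Poly_Mapping.single (var n) (x i)"
  let ?b' = "Poly_Mapping.single (Poly_Mapping.single n (mdeg k)) (monomial_value x k)"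
  have "Poly_Mapping.single m 1 - Poly_Mapping.single (Poly_Mapping.single n (mdeg m)) (monomial_value x m)
      = ?a * ?b - ?a' * ?b'"
    by (simp add: m mult_single mdeg_add monomial_value_add var_def flip: single_add)
  also have "\<dots> = (?a - ?a') * ?b + ?a' * (?b - ?b')" by (simp add: algebra_simps)
  also have "\<dots> \<in> Q"
  proof (rule ideal_poly_ringD(3)[OF Q])
    show "(?a - ?a') * ?b \<in> Q"
      using x[OF i_le] k unfolding linear_form_def by (intro ideal_poly_ringD(6)[OF Q] polys_single)
    show "?a' * (?b - ?b') \<in> Q"
      using Suc(1)[OF dk k] by (intro ideal_poly_ringD(5)[OF Q])
        (auto simp: var_def intro!: polys_single single_in_monomials)
  qed
  finally show ?case .
qed

text \<open>
  Modulo the forms \<open>t\<^sub>i - x\<^sub>i u\<close> a polynomial \<open>f\<close> is congruent to a polynomial in \<open>u\<close> alone, whose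
  coefficients are those of \<open>line_hom x f\<close>.
\<close>

lemma line_hom_kernel_subset:
  fixes Q :: "'a::comm_ring_1 mpoly set"
  assumes Q: "ideal Q (poly_ring (Suc n))" and x: "\<And>i. i \<le> n \<Longrightarrow> linear_form n i (x i) \<in> Q"
    and f: "f \<in> polys (Suc n)" "line_hom x f = 0"
  shows "f \<in> Q"
proof -
  let ?u = "\<lambda>m. Poly_Mapping.single (Poly_Mapping.single n (mdeg m))"
  let ?g = "\<Sum>m\<in>Poly_Mapping.keys f. ?u m (Poly_Mapping.lookup f m * monomial_value x m)"
  have "?g = 0"
  proof (rule poly_mapping_eqI)
    fix k
    show "Poly_Mapping.lookup ?g k = Poly_Mapping.lookup 0 k"
    proof (cases "\<exists>j. k = Poly_Mapping.single n j")
      case True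
      then obtain j where j: "k = Poly_Mapping.single n j" by blast
      have "Poly_Mapping.single n (mdeg m) = k \<longleftrightarrow> mdeg m = j" for m
        unfolding j by (metis lookup_single_eq)
      then have "Poly_Mapping.lookup ?g k = coeff (line_hom x f) j"
        by (simp add: lookup_sum lookup_single when_def line_hom_eq_sum coeff_sum)
      then show ?thesis using f by simp
    next
      case False
      then show ?thesis by (auto simp: lookup_sum lookup_single when_def intro!: sum.neutral)
    qed
  qed
  then have "f = f - ?g" by simp
  also have "\<dots> = (\<Sum>m\<in>Poly_Mapping.keys f. Poly_Mapping.single 0 (Poly_Mapping.lookup f m) *
      (Poly_Mapping.single m 1 - ?u m (monomial_value x m)))"
    by (subst mpoly_sum_singles[of f]) (simp add: sum_subtractf right_diff_distrib mult_single)
  also have "\<dots> \<in> Q"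
    using f(1) by (intro ideal_poly_ring_sum[OF Q] ideal_poly_ringD(5)[OF Q] monomial_mod_linear_forms[OF Q x] polys_single)
      (auto simp: polys_def)
  finally show ?thesis .
qed

text \<open>
  By the preceding lemma, \<open>P\<close>, \<open>Q\<close> and \<open>M\<close> contain the kernel of the surjection \<open>line_hom x\<close> onto \<open>K[z]\<close>,
  where nonzero prime ideals are maximal. The usual argument for principal ideal domains is carried
  out upstairs: \<open>h\<close> and \<open>g\<close> have images of least degree in the images of \<open>M\<close> and \<open>Q\<close>, hence generate
  them, and \<open>g = h k\<close> up to an element of \<open>P\<close>. Since \<open>Q\<close> is prime, it contains \<open>h\<close>, and then \<open>Q = M\<close>,
  or it contains \<open>k\<close>, and then \<open>h\<close> is a constant and \<open>M\<close> is the whole ring.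
\<close>

lemma no_long_chain_above_line:
  fixes P Q M :: "'a::field mpoly set"
  assumes P: "ideal P (poly_ring (Suc n))" and Q: "primeideal Q (poly_ring (Suc n))"
    and M: "primeideal M (poly_ring (Suc n))"
    and sub: "P \<subset> Q" "Q \<subset> M" and x: "x n = 1" "\<And>i. i < n \<Longrightarrow> linear_form n i (x i) \<in> P"
  shows False
proof -
  interpret Q: primeideal Q "poly_ring (Suc n)" by fact
  interpret M: primeideal M "poly_ring (Suc n)" by fact
  note QD = ideal_poly_ringD[OF Q.ideal_axioms] and MD = ideal_poly_ringD[OF M.ideal_axioms]
  let ?R = "polys (Suc n) :: 'a mpoly set"
  have "linear_form n i (x i) \<in> P" if "i \<le> n" for i
    using that x ideal_poly_ringD(2)[OF P] by (cases "i = n") (auto simp: linear_form_def)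
  then have ker: "f \<in> P" if "f \<in> ?R" "line_hom x f = 0" for f
    using line_hom_kernel_subset[OF P _ that] by blast
  obtain f1 where f1: "f1 \<in> Q" "line_hom x f1 \<noteq> 0"
    using sub(1) ker QD(1) by blast
  have "f1 \<in> M \<and> line_hom x f1 \<noteq> 0" using f1 sub by blast
  from ex_has_least_nat[of "\<lambda>f. f \<in> M \<and> line_hom x f \<noteq> 0", OF this, of "\<lambda>f. degree (line_hom x f)"]
  obtain h where h: "h \<in> M" "line_hom x h \<noteq> 0"
    "\<And>f. f \<in> M \<Longrightarrow> line_hom x f \<noteq> 0 \<Longrightarrow> degree (line_hom x h) \<le> degree (line_hom x f)"
    by blast
  have "f1 \<in> Q \<and> line_hom x f1 \<noteq> 0" using f1 by blast
  from ex_has_least_nat[of "\<lambda>f. f \<in> Q \<and> line_hom x f \<noteq> 0", OF this, of "\<lambda>f. degree (line_hom x f)"]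
  obtain g where g: "g \<in> Q" "line_hom x g \<noteq> 0"
    "\<And>f. f \<in> Q \<Longrightarrow> line_hom x f \<noteq> 0 \<Longrightarrow> degree (line_hom x g) \<le> degree (line_hom x f)"
    by blast
  have hR: "h \<in> ?R" using h(1) MD(1) by auto
  have div: "\<exists>q\<in>?R. line_hom x (f - h * q) = 0 \<and> f - h * q \<in> P" if f: "f \<in> M" for f
  proof -
    obtain q where q: "q \<in> ?R" "line_hom x q = line_hom x f div line_hom x h"
      using line_hom_surj[of x n, OF x(1)] by blast
    have eq: "line_hom x (f - h * q) = line_hom x f mod line_hom x h"
      by (simp add: line_hom_diff line_hom_mult q(2) minus_mult_div_eq_mod)
    have "f - h * q \<in> M" using MD(4)[OF f MD(6)[OF h(1) q(1)]] .
    then have "line_hom x (f - h * q) = 0"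
      using h(3)[of "f - h * q"] degree_mod_less[OF h(2), of "line_hom x f"] unfolding eq by force
    moreover have "f - h * q \<in> ?R" using MD(1) f q hR by (auto intro: polys_diff polys_mult)
    ultimately show ?thesis using ker q by blast
  qed
  obtain k where k: "k \<in> ?R" "g - h * k \<in> P" "line_hom x (g - h * k) = 0" using div[of g] g sub by blast
  have "g - (g - h * k) \<in> Q" using QD(4)[OF g(1)] k(2) sub by blast
  then have hk: "h * k \<in> Q" by simp
  consider "h \<in> Q" | "k \<in> Q" using Q.I_prime[of h k] hR k hk by auto
  then show False
  proof cases
    case 1
    have "M \<subseteq> Q"
    proof
      fix f assume f: "f \<in> M"
      obtain q where q: "q \<in> ?R" "f - h * q \<in> P" using div[OF f] by blast
      have "(f - h * q) + h * q \<in> Q" using q sub by (intro QD(3) QD(6)[OF 1]) auto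
      then show "f \<in> Q" by simp
    qed
    then show False using sub by blast
  next
    case 2
    have eq: "line_hom x g = line_hom x h * line_hom x k"
      using k(3) by (simp add: line_hom_diff line_hom_mult)
    then have nz: "line_hom x k \<noteq> 0" using g(2) by auto
    have "degree (line_hom x h) = 0"
      using g(3)[OF 2 nz] degree_mult_eq[OF h(2) nz] unfolding eq by simp
    then obtain c where c: "line_hom x h = [:c:]" using degree_eq_zeroE by blast
    let ?e = "Poly_Mapping.single 0 (inverse c) :: 'a mpoly"
    have e: "?e \<in> ?R" by (simp add: polys_single)
    have "c \<noteq> 0" using c h(2) by auto
    then have "line_hom x (1 - h * ?e) = 0"
      by (simp add: line_hom_diff line_hom_mult line_hom_one line_hom_single c monom_0 one_pCons)
    then have "1 - h * ?e \<in> P"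
      using ker[of "1 - h * ?e"] hR e by (simp add: polys_diff polys_mult)
    then have "(1 - h * ?e) + h * ?e \<in> M"
      using sub e by (intro MD(3) MD(6)[OF h(1)]) auto
    then have "1 \<in> M" by simp
    then show False using M.one_imp_carrier M.I_notcarr by simp
  qed
qed


lemma homog_polys_mult:
  fixes p q :: "'a::comm_ring_1 mpoly"
  shows "p \<in> homog_polys n d \<Longrightarrow> q \<in> homog_polys n e \<Longrightarrow> p * q \<in> homog_polys n (d + e)"
  unfolding homog_polys_eq by (rule supported_mult) (auto simp: mdeg_add add_in_monomials)

lemma homog_polys_prod:
  fixes f :: "'b \<Rightarrow> 'a::comm_ring_1 mpoly"
  assumes "\<And>i. i \<in> A \<Longrightarrow> f i \<in> homog_polys n 1"
  shows "(\<Prod>i\<in>A. f i) \<in> homog_polys n (card A)"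
  using assms
proof (induction A rule: infinite_finite_induct)
  case (insert i A)
  then have "f i * (\<Prod>i\<in>A. f i) \<in> homog_polys n (1 + card A)"
    by (intro homog_polys_mult) auto
  then show ?case using insert by simp
qed (auto simp: homog_polys_def)

lemma linear_form_homog: "i \<le> n \<Longrightarrow> linear_form n i a \<in> homog_polys (Suc n) 1"
  unfolding linear_form_def homog_polys_eq
  by (intro supported_diff supported_single) (auto simp: var_def intro: single_in_monomials)

text \<open>
  After setting \<open>u = 1\<close> the product becomes \<open>\<Prod>\<^sub>a (t\<^sub>i - a)\<close>, which vanishes at every point because \<open>a\<close> runs
  through all elements of the finite field.
\<close>

lemma prod_linear_forms_mem:
  fixes X :: "(nat \<Rightarrow> 'a::{field,finite}) set"
  assumes "i < n"
  shows "(\<Prod>a\<in>UNIV. linear_form n i a) \<in> homogenization n (vanishing_ideal n X)"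
proof (rule mem_homogenizationI[OF ideal_vanishing_ideal])
  let ?f = "\<Prod>a\<in>UNIV. linear_form n i a :: 'a mpoly"
  show f: "?f \<in> homog_polys (Suc n) (card (UNIV :: 'a set))"
    using assms by (intro homog_polys_prod linear_form_homog) simp
  have "strip_var n (var i) = var i" "strip_var n (var n) = 0"
    using assms by (auto intro!: poly_mapping_eqI simp: lookup_strip_var var_def lookup_single)
  then have lin: "dehomogenize n (linear_form n i a) = Poly_Mapping.single (var i) 1 - Poly_Mapping.single 0 a" for a :: 'a
    by (simp add: linear_form_def dehomogenize_diff dehomogenize_single)
  have "eval_mpoly x (dehomogenize n ?f) = (\<Prod>a\<in>UNIV. x i - a)" for x :: "nat \<Rightarrow> 'a"
    by (simp add: dehomogenize_prod lin eval_mpoly_prod eval_mpoly_diff eval_mpoly_single var_def)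
  then have "eval_mpoly x (dehomogenize n ?f) = 0" for x :: "nat \<Rightarrow> 'a"
    by (auto intro!: bexI[of _ "x i"] simp: prod_zero_iff)
  moreover have "dehomogenize n ?f \<in> polys n"
    using f by (intro dehomogenize_polys) (simp add: homog_polys_def)
  ultimately show "dehomogenize n ?f \<in> vanishing_ideal n X" by (simp add: vanishing_ideal_def)
qed

text \<open>
  On the line through the origin and \<open>(x, 1)\<close> the homogenization of \<open>g\<close> restricts to
  \<open>g(x) z\<^sup>e\<close> with \<open>e\<close> the degree of \<open>g\<close>.
\<close>

lemma line_hom_homogenization:
  fixes X :: "(nat \<Rightarrow> 'a::field) set"
  assumes x: "x \<in> X" and f: "f \<in> homogenization n (vanishing_ideal n X)"
  shows "line_hom (x(n := 1)) f = 0"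
proof -
  let ?y = "x(n := 1)"
  have gens: "line_hom ?y (homogenize n g) = 0" if g: "g \<in> vanishing_ideal n X" for g
  proof -
    have mv: "monomial_value ?y m = monomial_value x m" if "m \<in> Poly_Mapping.keys g" for m
    proof -
      have "n \<notin> Poly_Mapping.keys m" using g that by (auto simp: vanishing_ideal_def polys_def monomials_def)
      then show ?thesis unfolding monomial_value_def by (intro prod.cong) auto
    qed
    have "line_hom ?y (homogenize n g) = (\<Sum>m\<in>Poly_Mapping.keys g.
        monom (Poly_Mapping.lookup g m * monomial_value x m) (total_deg g))"
      unfolding homogenize_def line_hom_sum line_hom_single
      using mdeg_le_total_deg[of _ g] mv by (intro sum.cong) (auto simp: mdeg_add monomial_value_add)
    also have "\<dots> = monom (eval_mpoly x g) (total_deg g)"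
      by (rule poly_eqI) (simp add: eval_mpoly_def monomial_value_def coeff_sum)
    also have "\<dots> = 0" using g x by (simp add: vanishing_ideal_def)
    finally show ?thesis .
  qed
  have "homogenization n (vanishing_ideal n X) \<subseteq> {f \<in> polys (Suc n). line_hom ?y f = 0}"
    unfolding homogenization_def
  proof (rule genideal_least, rule ideal_poly_ringI)
    show "homogenize n ` vanishing_ideal n X \<subseteq> {f \<in> polys (Suc n). line_hom ?y f = 0}"
      using gens by (auto simp: homogenize_eq vanishing_ideal_def intro!: homogenize_to_polys)
  qed (auto simp: line_hom_zero line_hom_add line_hom_mult intro: polys_add polys_mult)
  then show ?thesis using f by blast
qed

text \<open>
  The ideals of the line through \<open>(x, 1)\<close>, for a point \<open>x\<close> of \<open>X\<close>, and of the origin on it form a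
  chain of two primes. Conversely, a prime ideal
  above \<open>I\<^sup>h\<close> contains the products of the forms \<open>t\<^sub>i - a u\<close> over all \<open>a\<close>, hence for each \<open>i\<close> one of the
  factors, and this leaves no room for a longer chain.
\<close>

lemma krull_dim_homogenization:
  fixes X :: "(nat \<Rightarrow> 'a::{field,finite}) set"
  assumes "X \<noteq> {}"
  shows "krull_dim (poly_ring (Suc n) Quot homogenization n (vanishing_ideal n X)) = enat 1"
proof -
  obtain x where x: "x \<in> X" using assms by blast
  let ?H = "homogenization n (vanishing_ideal n X)"
  let ?R = "poly_ring (Suc n) :: 'a mpoly ring"
  define y where "y = x(n := 1)"
  define P where "P T = {f \<in> polys (Suc n). line_hom y f \<in> T}" for T
  have H: "ideal ?H ?R" by (rule ideal_homogenization[OF ideal_vanishing_ideal])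
  show ?thesis
  proof (rule cring.krull_dim_quotient_eq_1[OF cring_poly_ring H])
    show "primeideal (P {0}) ?R" "primeideal (P {p. coeff p 0 = 0}) ?R"
      unfolding P_def by (rule primeideal_line_preimage; auto simp: coeff_mult_0)+
    show "?H \<subseteq> P {0}"
      using line_hom_homogenization[OF x] ideal_poly_ringD(1)[OF H] by (auto simp: P_def y_def)
    have "Poly_Mapping.single (var n) 1 \<in> P {p. coeff p 0 = 0} - P {0}"
      by (auto simp: P_def var_def y_def line_hom_single intro!: polys_single single_in_monomials)
    then show "P {0} \<subset> P {p. coeff p 0 = 0}" by (auto simp: P_def)
  next
    fix A B C assume ABC: "primeideal A ?R" "primeideal B ?R" "primeideal C ?R" "?H \<subseteq> A" "A \<subset> B" "B \<subset> C"
    have "\<exists>a. linear_form n i a \<in> A" if "i < n" for i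
      using primeideal_prod_mem[OF ABC(1), of UNIV "linear_form n i"] prod_linear_forms_mem[OF that, of X]
        ABC(4) linear_form_polys[of i n] that by auto
    then obtain a where a: "\<And>i. i < n \<Longrightarrow> linear_form n i (a i) \<in> A" by metis
    show False
    proof (rule no_long_chain_above_line[OF _ ABC(2,3,5,6)])
      show "ideal A ?R" using ABC(1) by (simp add: primeideal_def)
      show "linear_form n i ((a(n := 1)) i) \<in> A" if "i < n" for i
        using a[OF that] that by simp
    qed simp
  qed
qed

section \<open>Palindromes and the h-vector\<close>

lemma affine_hilbert_neg:
  fixes I :: "'a::{field,finite} mpoly set"
  assumes "ideal I (poly_ring n)"
  shows "affine_hilbert n I (-1) = 0"
proof -
  have le: "polys_le n (-1) = (supported {} :: 'a mpoly set)" by (simp add: polys_le_eq)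
  have "quotient_dim (supported {}) (I \<inter> supported {}) = card ({} :: nat set)"
  proof (rule quotient_dim_eqI[where b = "\<lambda>_. 0"])
    show "lin_subspace (I \<inter> supported {})"
      by (intro lin_subspace_Int lin_subspace_supported lin_subspace_ideal[OF assms])
    show "\<exists>c. v - (\<Sum>m\<in>{}. Poly_Mapping.single 0 (c m) * 0) \<in> I \<inter> supported {}"
      if "v \<in> supported {}" for v
    proof -
      have "v = 0" using that by (auto simp: supported_def intro!: poly_mapping_eqI)
      then show ?thesis using ideal_poly_ringD(2)[OF assms] by (simp add: supported_zero)
    qed
  qed (auto simp: lin_subspace_supported)
  then show ?thesis by (simp add: affine_hilbert_def le)
qed

text \<open>
  The difference of the equations for \<open>e\<close> and \<open>e + 1\<close> is \<open>\<delta> e = \<delta> (r - e)\<close>, and the equation for \<open>e = 0\<close> is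
  trivial.
\<close>

lemma palindrome_iff_partial_sums:
  fixes \<delta> :: "nat \<Rightarrow> nat"
  shows "(\<forall>e\<le>Suc r. sum \<delta> {..<e} + sum \<delta> {..<Suc r - e} = sum \<delta> {..<Suc r}) \<longleftrightarrow>
    (\<forall>i\<le>r. \<delta> i = \<delta> (r - i))" (is "?sums \<longleftrightarrow> ?pal")
proof
  assume sums: ?sums
  show ?pal
  proof (intro allI impI)
    fix i assume i: "i \<le> r"
    then have "sum \<delta> {..<i} + sum \<delta> {..<Suc (r - i)} = sum \<delta> {..<Suc i} + sum \<delta> {..<r - i}"
      using sums[rule_format, of i] sums[rule_format, of "Suc i"] by (simp add: Suc_diff_le del: sum.lessThan_Suc)
    then show "\<delta> i = \<delta> (r - i)" by simp
  qed
next
  assume pal: ?pal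
  show ?sums
  proof (intro allI impI)
    fix e assume "e \<le> Suc r"
    then show "sum \<delta> {..<e} + sum \<delta> {..<Suc r - e} = sum \<delta> {..<Suc r}"
    proof (induction e)
      case (Suc e)
      then have "Suc r - e = Suc (r - e)" "e \<le> r" by simp_all
      then show ?case using Suc pal[rule_format, of e] by simp
    qed simp
  qed
qed

context graded_order_ideal
begin

lemma affine_hilbert_eq_partial_sum:
  assumes "-1 \<le> d"
  shows "affine_hilbert n I d = (\<Sum>i<nat (d + 1). card (standard_deg i))"
proof (cases "d = -1")
  case True
  then show ?thesis by (simp add: affine_hilbert_neg[OF ideal])
next
  case False
  then have "0 \<le> d" using assms by linarith
  then obtain k where k: "d = int k" using nonneg_int_cases by blast
  then have "nat (d + 1) = Suc k" by simp
  then show ?thesis using affine_hilbert_sum[of k] k by (simp add: lessThan_Suc_atMost)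
qed

text \<open>
  The Hilbert function of \<open>S[u]/I\<^sup>h\<close> consists of the partial sums of \<open>\<delta> i = card (standard_deg i)\<close>, so
  multiplying its generating function by \<open>1 - z\<close> leaves the polynomial with coefficients \<open>\<delta> i\<close>. Its
  value at 1 is the total number of standard monomials, which is positive.
\<close>

lemma h_vector_homogenization:
  assumes krull: "krull_dim (poly_ring (Suc n) Quot homogenization n I) = enat 1"
    and top: "card (standard_deg r0) \<noteq> 0" "\<And>i. r0 < i \<Longrightarrow> card (standard_deg i) = 0"
  shows "h_vector (Suc n) (homogenization n I) = map (\<lambda>i. int (card (standard_deg i))) [0..<Suc r0]"
proof -
  let ?H = "homogenization n I"
  define \<delta> where "\<delta> i = int (card (standard_deg i))" for i
  define h where "h = (\<Sum>i\<le>r0. monom (\<delta> i) i)"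
  have coeff_h: "coeff h i = \<delta> i" for i
    using top(2)[of i] by (simp add: h_def coeff_sum \<delta>_def)
  have deg: "degree h = r0"
  proof (rule order.antisym)
    show "degree h \<le> r0" using top(2) by (intro degree_le) (simp add: coeff_h \<delta>_def)
    show "r0 \<le> degree h" using top(1) by (intro le_degree) (simp add: coeff_h \<delta>_def)
  qed
  have H_int: "int (hilbert (Suc n) ?H i) = (\<Sum>j\<le>i. \<delta> j)" for i
    by (simp add: hilbert_homogenization affine_hilbert_sum \<delta>_def)
  have series: "hilbert_series (Suc n) ?H * (1 - fps_X) = fps_of_poly h"
  proof (rule fps_ext)
    fix i
    show "fps_nth (hilbert_series (Suc n) ?H * (1 - fps_X)) i = fps_nth (fps_of_poly h) i"
      by (cases i) (simp_all add: right_diff_distrib hilbert_series_def H_int coeff_h)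
  qed
  have "poly h 1 = (\<Sum>i\<le>r0. \<delta> i)" by (simp add: h_def poly_sum poly_monom)
  moreover have "(\<Sum>i\<le>r0. \<delta> i) \<ge> \<delta> r0" by (rule member_le_sum) (auto simp: \<delta>_def)
  ultimately have "poly h 1 \<noteq> 0" using top(1) by (simp add: \<delta>_def)
  then have "h_polynomial (Suc n) ?H = h"
    unfolding h_polynomial_def krull using series by (intro the_equality) (auto simp: fps_of_poly_eq_iff)
  then show ?thesis
    using deg coeff_h top(1) unfolding h_vector_def coeffs_def by (auto simp: \<delta>_def)
qed

lemma palindromic_h_vector_iff:
  assumes krull: "krull_dim (poly_ring (Suc n) Quot homogenization n I) = enat 1"
    and top: "card (standard_deg r0) \<noteq> 0" "\<And>i. r0 < i \<Longrightarrow> card (standard_deg i) = 0"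
  shows "symmetric_vector (h_vector (Suc n) (homogenization n I)) \<longleftrightarrow>
    (\<forall>i\<le>r0. card (standard_deg i) = card (standard_deg (r0 - i)))"
proof -
  have h: "h_vector (Suc n) (homogenization n I) = map (\<lambda>i. int (card (standard_deg i))) [0..<Suc r0]"
    by (rule h_vector_homogenization[OF krull top])
  show ?thesis unfolding h symmetric_vector_def by (auto simp: less_Suc_eq_le simp del: upt_Suc)
qed

lemma affine_hilbert_symmetry_iff:
  assumes "affine_hilbert n I (int r0) = N"
  shows "(\<forall>d::int. -1 \<le> d \<and> d \<le> int r0 \<longrightarrow> affine_hilbert n I d + affine_hilbert n I (int r0 - d - 1) = N) \<longleftrightarrow>
    (\<forall>i\<le>r0. card (standard_deg i) = card (standard_deg (r0 - i)))" (is "?L \<longleftrightarrow> _")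
proof -
  define S where "S e = (\<Sum>i<e. card (standard_deg i))" for e
  have H: "affine_hilbert n I d = S (nat (d + 1))" if "-1 \<le> d" for d
    using affine_hilbert_eq_partial_sum[OF that] by (simp add: S_def)
  have N: "N = S (Suc r0)" using assms H[of "int r0"] by (simp add: nat_add_distrib)
  \<comment> \<open>The substitution \<open>e = d + 1\<close> moves the range \<open>-1, \<dots>, r0\<close> of \<open>d\<close> to the natural numbers.\<close>
  have "?L \<longleftrightarrow> (\<forall>e\<le>Suc r0. S e + S (Suc r0 - e) = S (Suc r0))"
  proof
    assume L: ?L
    show "\<forall>e\<le>Suc r0. S e + S (Suc r0 - e) = S (Suc r0)"
    proof (intro allI impI)
      fix e assume e: "e \<le> Suc r0"
      have "affine_hilbert n I (int e - 1) + affine_hilbert n I (int r0 - (int e - 1) - 1) = N"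
        using L[rule_format, of "int e - 1"] e by simp
      moreover have "nat (int r0 - (int e - 1) - 1 + 1) = Suc r0 - e" using e by simp
      ultimately show "S e + S (Suc r0 - e) = S (Suc r0)" using e by (simp add: H N)
    qed
  next
    assume R: "\<forall>e\<le>Suc r0. S e + S (Suc r0 - e) = S (Suc r0)"
    show ?L
    proof (intro allI impI)
      fix d :: int assume d: "-1 \<le> d \<and> d \<le> int r0"
      have "nat (int r0 - d - 1 + 1) = Suc r0 - nat (d + 1)" "nat (d + 1) \<le> Suc r0"
        using d by linarith+
      then show "affine_hilbert n I d + affine_hilbert n I (int r0 - d - 1) = N"
        using R[rule_format, of "nat (d + 1)"] d by (simp add: H N)
    qed
  qed
  then show ?thesis unfolding S_def palindrome_iff_partial_sums .
qed

end

lemma graded_monomial_order_restrict: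
  assumes r: "graded_monomial_order n r" and "k \<le> n"
  shows "graded_monomial_order k (Restr r (monomials k))"
proof -
  have sub: "monomials k \<subseteq> monomials n" by (rule monomials_mono[OF assms(2)])
  have "linear_order_on (monomials n) r"
    using r by (simp add: graded_monomial_order_def monomial_order_def)
  then have "refl_on (monomials n) r" "antisym r" "trans r" "total_on (monomials n) r"
    by (auto simp: order_on_defs)
  then have "refl_on (monomials k) (Restr r (monomials k))" "antisym (Restr r (monomials k))"
    "trans (Restr r (monomials k))" "total_on (monomials k) (Restr r (monomials k))"
    using sub by (auto simp: refl_on_def total_on_def subset_iff antisym_def intro: trans_Restr)
  then have "linear_order_on (monomials k) (Restr r (monomials k))"
    by (auto simp: order_on_defs)
  then show ?thesis
    using r sub by (auto simp: graded_monomial_order_def monomial_order_def add_in_monomials subset_iff)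
qed

theorem proposition2p8:
  fixes s r0 :: nat
    and X :: "(nat \<Rightarrow> 'a::{field,finite}) set"
    and I :: "'a mpoly set"
    and r r' :: "monomial rel"
  assumes "X \<subseteq> affine_space s"
    and "card X \<ge> 2"
    and "I = vanishing_ideal s X"
    and "r0 = regularity_index s X"
    and "graded_monomial_order (Suc s) r"
    and "\<forall>i j. i < j \<and> j \<le> s \<longrightarrow> (var j, var i) \<in> r"
    and "r' = Restr r (monomials s)"
  shows "(symmetric_vector (h_vector (Suc s) (homogenization s I)) \<longleftrightarrow>
          (\<forall>d::int. -1 \<le> d \<and> d \<le> int r0 \<longrightarrow>
             affine_hilbert s I d + affine_hilbert s I (int r0 - d - 1) = card X)) \<and>
         ((\<forall>d::int. -1 \<le> d \<and> d \<le> int r0 \<longrightarrow>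
             affine_hilbert s I d + affine_hilbert s I (int r0 - d - 1) = card X) \<longleftrightarrow>
          (\<forall>d\<le>r0. hilbert s (initial_ideal s r' I) d
                = hilbert s (initial_ideal s r' I) (r0 - d))) \<and>
         ((\<forall>d\<le>r0. hilbert s (initial_ideal s r' I) d
                = hilbert s (initial_ideal s r' I) (r0 - d)) \<longleftrightarrow>
          (\<forall>d\<le>r0. card (standard_monomials s r' I \<inter> homog_polys s d)
                = card (standard_monomials s r' I \<inter> homog_polys s (r0 - d))))"
proof -
  have "graded_order s r'"
    unfolding graded_order_def assms(7) using graded_monomial_order_restrict[OF assms(5)] by simp
  moreover have "ideal I (poly_ring s)"
    unfolding assms(3) by (rule ideal_vanishing_ideal)
  ultimately interpret graded_order_ideal s r' I
    by (intro graded_order_ideal.intro graded_order_ideal_axioms.intro)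
  have X: "finite X" "X \<noteq> {}"
    using assms(2) by (auto intro!: card_ge_0_finite)
  let ?stable = "\<lambda>l. \<forall>d\<ge>int l. affine_hilbert s I d = card X"
  have ex: "\<exists>l. ?stable l"
    using affine_hilbert_eventually_card[OF X(1) assms(1)] assms(3) by blast
  have r0: "r0 = (LEAST l. ?stable l)"
    using assms(3,4) by (simp add: regularity_index_def)
  have stable: "?stable r0"
    unfolding r0 by (rule LeastI_ex[OF ex])
  have H: "affine_hilbert s I (int d) = (\<Sum>i\<le>d. card (standard_deg i))" for d
    by (rule affine_hilbert_sum)
  \<comment> \<open>The partial sums of the numbers of standard monomials are constant from \<open>r0\<close> on.\<close>
  have above: "card (standard_deg i) = 0" if i: "r0 < i" for i
  proof -
    obtain j where j: "i = Suc j" using i by (cases i) auto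
    have "affine_hilbert s I (int i) = affine_hilbert s I (int j)" using stable i j by simp
    then show ?thesis by (simp only: H j sum.atMost_Suc)
  qed
  \<comment> \<open>Otherwise the affine Hilbert function would already be stable from \<open>r0 - 1\<close> on,
    or, if \<open>r0 = 0\<close>, would be 0 there although \<open>X\<close> is nonempty.\<close>
  have top: "card (standard_deg r0) \<noteq> 0"
  proof
    assume 0: "card (standard_deg r0) = 0"
    show False
    proof (cases r0)
      case 0
      then show ?thesis using stable H[of 0] \<open>card (standard_deg r0) = 0\<close> assms(2) by auto
    next
      case (Suc j)
      have j: "affine_hilbert s I (int j) = card X"
      proof -
        have "affine_hilbert s I (int r0) = card X" using stable by simp
        then show ?thesis using 0 unfolding H Suc by simp
      qed
      have "?stable j"
      proof (intro allI impI)
        fix d assume d: "int j \<le> d"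
        then consider "d = int j" | "int r0 \<le> d" using Suc by linarith
        then show "affine_hilbert s I d = card X" using j stable by cases auto
      qed
      then have "r0 \<le> j" unfolding r0 by (rule Least_le)
      then show ?thesis using Suc by simp
    qed
  qed
  have krull: "krull_dim (poly_ring (Suc s) Quot homogenization s I) = enat 1"
    unfolding assms(3) by (rule krull_dim_homogenization[OF X(2)])
  have b: "affine_hilbert s I (int r0) = card X" using stable by simp
  show ?thesis
    unfolding affine_hilbert_symmetry_iff[OF b] hilbert_initial_ideal card_standard_monomials
    using palindromic_h_vector_iff[OF krull top above] by simp
qed

end
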